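(* Let $p_\phi$ be a program that is safe with respect to a variable typing environment $\Gamma$ and a safe operator typing environment $\Delta$. Then there is a polynomial $P$ such that for every oracle $\phi$, every store $\mu$ and every derivation $\pi_\phi:\mu\models p_\phi\to w$, we have $|\pi_\phi|\le P(m_\mu^{p_\phi})$.
   Context: Words and programs. Fix a finite alphabet $\Sigma\supseteq\{0,1\}$ and let $\mathbb{W}=\Sigma^*$ ($\epsilon$ the empty word, $|w|$ the length of $w$); $v\unlhd w$ means $w=u.v.u'$ for some words $u,u'$. Fix a set $\mathbb{V}$ of variables and a set of operators, each operator $\mathtt{op}$ having an arity $ar(\mathtt{op})\ge 0$ and a total function $[\![\mathtt{op}]\!]:\mathbb{W}^{ar(\mathtt{op})}\to\mathbb{W}$. With a single oracle symbol $\phi$: expressions $e::=x\mid \mathtt{op}(e_1,\dots,e_{ar(\mathtt{op})})\mid \phi(e_1\upharpoonright e_2)$; commands $c::=\mathtt{skip}\mid x:=e\mid c_1;c_2\mid \mathtt{if}(e)\{c_1\}\,\mathtt{else}\,\{c_0\}\mid \mathtt{while}(e)\{c\}$; programs $p_\phi::=c\ \mathtt{return}\ x$. Semantics. For $w\in\mathbb{W}$, $n\in\mathbb{N}$, $w_{\upharpoonright n}$ is $w$ truncated to its first $\min(n,|w|)$ symbols followed by a word $10^k$ making the length exactly $n+1$; $[\![\upharpoonright]\!](v,w)=v_{\upharpoonright |w|}$. An oracle is a total function $\phi:\mathbb{W}\to\mathbb{W}$. A store is a partial map $\mu:\mathbb{V}\to\mathbb{W}$, of size $|\mu|=\sum_{x\in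 dom(\mu)}|\mu(x)|$. Given $\phi$, the deterministic big-step semantics is given by the rules: $\mu\models x\to\mu(x)$; $\mu\models\mathtt{op}(\bar e)\to[\![\mathtt{op}]\!](\bar w)$ if $\mu\models e_i\to w_i$ for all $i$; (oracle rule) $\mu\models\phi(e_1\upharpoonright e_2)\to\phi([\![\upharpoonright]\!](v,w))$ if $\mu\models e_1\to v$, $\mu\models e_2\to w$; $\mu\models\mathtt{skip}\to\mu$; $\mu\models x:=e\to\mu[x\leftarrow w]$ if $\mu\models e\to w$; $\mu\models c_1;c_2\to\mu_2$ if $\mu\models c_1\to\mu_1$ and $\mu_1\models c_2\to\mu_2$; $\mu\models\mathtt{if}(e)\{c_1\}\mathtt{else}\{c_0\}\to\mu'$ if $\mu\models e\to b$ with $b\in\{0,1\}$ and $\mu\models c_b\to\mu'$; $\mu\models\mathtt{while}(e)\{c\}\to\mu$ if $\mu\models e\to 0$; $\mu\models\mathtt{while}(e)\{c\}\to\mu'$ if $\mu\models e\to1$ and $\mu\models c;\mathtt{while}(e)\{c\}\to\mu'$; $\mu\models c\ \mathtt{return}\ x\to\mu'(x)$ if $\mu\models c\to\mu'$. A derivation $\pi_\phi$ is a proof tree built from these rules; $|\pi_\phi|$ is its number of nodes. $m_\mu^{p_\phi}$ is the maximum of $|\mu|$ and of the lengths $|\phi([\![\upharpoonright]\!](v,w))|$ over all applications of the oracle rule occurring in $\pi_\phi:\mu\models p_\phi\to w$. Operators. $\mathtt{op}$ is neutral if $ar(\mathtt{op})=0$, or $[\![\mathtt{op}]\!]$ takes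 values in $\{0,1\}$, or for all $\bar w$ there is $i$ with $[\![\mathtt{op}]\!](\bar w)\unlhd w_i$. $\mathtt{op}$ is positive if there is a constant $c$ with $|[\![\mathtt{op}]\!](\bar w)|\le\max_i|w_i|+c$ for all $\bar w$. Typing. Tiers are natural numbers $\mathbf 0,\mathbf 1,\dots$ with the usual order $\preceq$ (strict: $\prec$), $\vee=\max$, $\wedge=\min$. A variable typing environment $\Gamma$ maps variables to tiers; an operator typing environment $\Delta$ assigns to each operator $\mathtt{op}$ and tier $t$ a set $\Delta(\mathtt{op})(t)$ of types $t_1\to\dots\to t_{ar(\mathtt{op})}\to t'$. Judgments $\Gamma,\Delta\vdash b:(t,t_{in},t_{out})$ are derived by the rules (writing $\vdash$ for $\Gamma,\Delta\vdash$, all tiers arbitrary): (V) $\vdash x:(\Gamma(x),t_{in},t_{out})$; (OP) if $t_1\to\dots\to t_n\to t\in\Delta(\mathtt{op})(t_{in})$ and $\vdash e_i:(t_i,t_{in},t_{out})$ for all $i\le n=ar(\mathtt{op})$ then $\vdash\mathtt{op}(e_1,\dots,e_n):(t,t_{in},t_{out})$; (OR) if $\vdash e_1:(t,t_{in},t_{out})$, $\vdash e_2:(t_{out},t_{in},t_{out})$, $t\prec t_{in}$ and $t\preceq t_{out}$ then $\vdash\phi(e_1\upharpoonright e_2):(t,t_{in},t_{out})$; (SUB) for a command $c$, if $\vdash c:(t,t_{in},t_{out})$ then $\vdash c:(t+1,t_{in},t_{out})$; (SK) $\vdash\mathtt{skip}:(\mathbf0,t_{in},t_{out})$; (A) if $\vdash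 x:(t_1,t_{in},t_{out})$, $\vdash e:(t_2,t_{in},t_{out})$, $t_1\preceq t_2$ then $\vdash x:=e:(t_1,t_{in},t_{out})$; (S) if $\vdash c_1:\tau$ and $\vdash c_2:\tau$ then $\vdash c_1;c_2:\tau$; (C) if $\vdash e:\tau$, $\vdash c_1:\tau$, $\vdash c_0:\tau$ then $\vdash\mathtt{if}(e)\{c_1\}\mathtt{else}\{c_0\}:\tau$; (W) if $\vdash e:(t,t_{in},t_{out})$, $\vdash c:(t,t,t_{out})$ and $\mathbf1\preceq t\preceq t_{out}$ then $\vdash\mathtt{while}(e)\{c\}:(t,t_{in},t_{out})$; (W$_0$) if $\vdash e:(t,t_{in},t)$, $\vdash c:(t,t,t)$ and $\mathbf1\preceq t$ then $\vdash\mathtt{while}(e)\{c\}:(t,t_{in},\mathbf0)$. Safety. $\Delta$ is safe if for each operator $\mathtt{op}$ it types with $ar(\mathtt{op})>0$: $\mathtt{op}$ is neutral or positive, $[\![\mathtt{op}]\!]$ is polynomial-time computable, and for every tier $t_{in}$ and every $t_1\to\dots\to t_n\to t\in\Delta(\mathtt{op})(t_{in})$: $t\preceq\wedge_i t_i\preceq\vee_i t_i\preceq t_{in}$, and $t\prec t_{in}$ if $\mathtt{op}$ is positive but not neutral. A program $c\ \mathtt{return}\ x$ is safe with respect to $\Gamma,\Delta$ if $\Delta$ is safe and $\Gamma,\Delta\vdash c:(t,t_{in},t_{out})$ for some tiers. *)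

theory Defs
  imports
    "HOL-Library.Sublist"
    "HOL-Computational_Algebra.Polynomial"
begin

text \<open>
  The alphabet is a type of the classes \<^class>\<open>finite\<close> and \<^class>\<open>zero_neq_one\<close>; the
  latter only provides two distinct letters 0 and 1. Throughout, \<open>ar\<close> gives the
  arity of each operator and \<open>sem\<close> its interpretation: \<open>sem f\<close> is meaningful on lists of length
  \<open>ar f\<close> only.
\<close>

type_synonym 'a word = "'a list"

section \<open>Syntax and semantics\<close>

text \<open>The arity constraint on \<open>Op f es\<close> is imposed by the typing and evaluation rules.\<close>

datatype ('v, 'f) expr =
    Var 'v
  | Op 'f "('v, 'f) expr list"
  | Oracle "('v, 'f) expr" "('v, 'f) expr"

datatype ('v, 'f) com =
    Skip
  | Assign 'v "('v, 'f) expr"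
  | Seq "('v, 'f) com" "('v, 'f) com"
  | Cond "('v, 'f) expr" "('v, 'f) com" "('v, 'f) com"
  | While "('v, 'f) expr" "('v, 'f) com"

datatype ('v, 'f) prog = Return "('v, 'f) com" 'v

type_synonym ('v, 'a) store = "'v \<rightharpoonup> 'a word"

definition trunc :: "'a::zero_neq_one word \<Rightarrow> nat \<Rightarrow> 'a word" where
  "trunc w n = take n w @ [1] @ replicate (n - length w) 0"

lemma length_trunc: "length (trunc w n) = n + 1"
  by (simp add: trunc_def)

definition trunc_word :: "'a::zero_neq_one word \<Rightarrow> 'a word \<Rightarrow> 'a word" where
  "trunc_word v w = trunc v (length w)"

datatype ('v, 'f, 'a) judgement =
    EvalE "('v, 'a) store" "('v, 'f) expr" "'a word"
  | EvalC "('v, 'a) store" "('v, 'f) com" "('v, 'a) store"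
  | EvalP "('v, 'a) store" "('v, 'f) prog" "'a word"

text \<open>\<open>rule_instance ar sem \<phi> Js J\<close>: the judgement \<open>J\<close> follows from the list of premises
  \<open>Js\<close> by one rule of the big-step semantics.\<close>

inductive rule_instance ::
  "('f \<Rightarrow> nat) \<Rightarrow> ('f \<Rightarrow> 'a::zero_neq_one word list \<Rightarrow> 'a word) \<Rightarrow> ('a word \<Rightarrow> 'a word)
    \<Rightarrow> ('v, 'f, 'a) judgement list \<Rightarrow> ('v, 'f, 'a) judgement \<Rightarrow> bool"
  for ar sem \<phi> where
  Var: "\<mu> x = Some w \<Longrightarrow> rule_instance ar sem \<phi> [] (EvalE \<mu> (Var x) w)"
| Op: "length es = ar f \<Longrightarrow> length ws = ar f \<Longrightarrow>
    rule_instance ar sem \<phi> (map2 (EvalE \<mu>) es ws) (EvalE \<mu> (Op f es) (sem f ws))"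
| Oracle: "rule_instance ar sem \<phi> [EvalE \<mu> e1 v, EvalE \<mu> e2 w]
    (EvalE \<mu> (Oracle e1 e2) (\<phi> (trunc_word v w)))"
| Skip: "rule_instance ar sem \<phi> [] (EvalC \<mu> Skip \<mu>)"
| Assign: "rule_instance ar sem \<phi> [EvalE \<mu> e w] (EvalC \<mu> (Assign x e) (\<mu>(x \<mapsto> w)))"
| Seq: "rule_instance ar sem \<phi> [EvalC \<mu> c1 \<mu>1, EvalC \<mu>1 c2 \<mu>2] (EvalC \<mu> (Seq c1 c2) \<mu>2)"
| Cond1: "rule_instance ar sem \<phi> [EvalE \<mu> e [1], EvalC \<mu> c1 \<mu>'] (EvalC \<mu> (Cond e c1 c0) \<mu>')"
| Cond0: "rule_instance ar sem \<phi> [EvalE \<mu> e [0], EvalC \<mu> c0 \<mu>'] (EvalC \<mu> (Cond e c1 c0) \<mu>')"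
| While0: "rule_instance ar sem \<phi> [EvalE \<mu> e [0]] (EvalC \<mu> (While e c) \<mu>)"
| While1: "rule_instance ar sem \<phi> [EvalE \<mu> e [1], EvalC \<mu> (Seq c (While e c)) \<mu>']
    (EvalC \<mu> (While e c) \<mu>')"
| Return: "\<mu>' x = Some w \<Longrightarrow>
    rule_instance ar sem \<phi> [EvalC \<mu> c \<mu>'] (EvalP \<mu> (Return c x) w)"

datatype 'j ptree = Infer (concl: 'j) (prems: "'j ptree list")

fun num_nodes :: "'j ptree \<Rightarrow> nat" where
  "num_nodes (Infer J \<pi>s) = 1 + sum_list (map num_nodes \<pi>s)"

inductive derivation ::
  "('f \<Rightarrow> nat) \<Rightarrow> ('f \<Rightarrow> 'a::zero_neq_one word list \<Rightarrow> 'a word) \<Rightarrow> ('a word \<Rightarrow> 'a word)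
    \<Rightarrow> ('v, 'f, 'a) judgement ptree \<Rightarrow> bool"
  for ar sem \<phi> where
  "rule_instance ar sem \<phi> (map concl \<pi>s) J \<Longrightarrow> (\<And>\<pi>. \<pi> \<in> set \<pi>s \<Longrightarrow> derivation ar sem \<phi> \<pi>)
    \<Longrightarrow> derivation ar sem \<phi> (Infer J \<pi>s)"

text \<open>The size of a store is finite iff only finitely many variables hold a nonempty word. In
  particular every store with finite domain qualifies, and there the sum below is the sum over the
  whole domain. For other stores the size is infinite and \<open>store_size\<close> is meaningless.\<close>

definition nonempty_vars :: "('v, 'a) store \<Rightarrow> 'v set" where
  "nonempty_vars \<mu> = {x \<in> dom \<mu>. the (\<mu> x) \<noteq> []}"

definition finite_size :: "('v, 'a) store \<Rightarrow> bool" where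
  "finite_size \<mu> \<longleftrightarrow> finite (nonempty_vars \<mu>)"

definition store_size :: "('v, 'a) store \<Rightarrow> nat" where
  "store_size \<mu> = (\<Sum>x\<in>nonempty_vars \<mu>. length (the (\<mu> x)))"

lemma finite_dom_store_size:
  assumes "finite (dom \<mu>)"
  shows "finite_size \<mu>" "store_size \<mu> = (\<Sum>x\<in>dom \<mu>. length (the (\<mu> x)))"
proof -
  have sub: "nonempty_vars \<mu> \<subseteq> dom \<mu>"
    by (auto simp: nonempty_vars_def)
  then show "finite_size \<mu>"
    using assms finite_subset by (auto simp: finite_size_def)
  show "store_size \<mu> = (\<Sum>x\<in>dom \<mu>. length (the (\<mu> x)))"
    unfolding store_size_def
    by (rule sum.mono_neutral_left[OF assms sub]) (auto simp: nonempty_vars_def)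
qed

text \<open>A node of a derivation whose expression is an oracle call can only be an application of
  the oracle rule, and the word in its conclusion is the value \<open>\<phi> (trunc_word v w)\<close> returned by the
  oracle.\<close>

definition oracle_answers :: "('v, 'f, 'a) judgement ptree \<Rightarrow> 'a word set" where
  "oracle_answers \<pi> = {w. \<exists>\<mu> e1 e2. EvalE \<mu> (Oracle e1 e2) w \<in> set_ptree \<pi>}"

definition max_size :: "('v, 'a) store \<Rightarrow> ('v, 'f, 'a) judgement ptree \<Rightarrow> nat" where
  "max_size \<mu> \<pi> = Max (insert (store_size \<mu>) (length ` oracle_answers \<pi>))"

section \<open>Polynomial-time computability\<close>

text \<open>
  Deterministic Turing machines with an arbitrary number of two-way infinite tapes over the
  alphabet extended by a blank (\<open>None\<close>). The states are \<open>{..<num_states}\<close>, with initial state 0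
  and halting state 1. The arguments of an \<open>n\<close>-ary function are on tapes \<open>0, \<dots>, n - 1\<close>,
  starting at cell 0; the result is expected on tape \<open>n\<close>. A transition maps a state and the list of
  scanned symbols to a state and, for each tape, the symbol to be written and the head move.
\<close>

datatype move = MoveLeft | Stay | MoveRight

type_synonym 'a tape = "int \<times> (int \<Rightarrow> 'a option)"

type_synonym 'a config = "nat \<times> 'a tape list"

record 'a tm =
  num_tapes :: nat
  num_states :: nat
  transition :: "nat \<Rightarrow> 'a option list \<Rightarrow> nat \<times> ('a option \<times> move) list"

definition wf_tm :: "'a tm \<Rightarrow> bool" where
  "wf_tm M \<longleftrightarrow> 2 \<le> num_states M \<and>
    (\<forall>q<num_states M. \<forall>ss. length ss = num_tapes M \<longrightarrow>
      fst (transition M q ss) < num_states M \<and> length (snd (transition M q ss)) = num_tapes M)"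

fun offset :: "move \<Rightarrow> int" where
  "offset MoveLeft = -1"
| "offset Stay = 0"
| "offset MoveRight = 1"

fun act :: "'a option \<times> move \<Rightarrow> 'a tape \<Rightarrow> 'a tape" where
  "act (s, m) (h, T) = (h + offset m, T(h := s))"

definition step :: "'a tm \<Rightarrow> 'a config \<Rightarrow> 'a config" where
  "step M C = (case C of (q, Ts) \<Rightarrow>
    if q = 1 then C
    else let (q', as) = transition M q (map (\<lambda>(h, T). T h) Ts) in (q', map2 act as Ts))"

definition word_cells :: "'a word \<Rightarrow> int \<Rightarrow> 'a option" where
  "word_cells w i = (if 0 \<le> i \<and> i < int (length w) then Some (w ! nat i) else None)"

definition init_config :: "'a tm \<Rightarrow> 'a word list \<Rightarrow> 'a config" where
  "init_config M ws =
    (0, map (\<lambda>w. (0, word_cells w)) ws @ replicate (num_tapes M - length ws) (0, word_cells []))"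

definition halts_within :: "'a tm \<Rightarrow> 'a word list \<Rightarrow> nat \<Rightarrow> 'a word \<Rightarrow> bool" where
  "halts_within M ws t v \<longleftrightarrow> (case (step M ^^ t) (init_config M ws) of (q, Ts) \<Rightarrow>
    q = 1 \<and> snd (Ts ! length ws) = word_cells v)"

definition polytime :: "nat \<Rightarrow> ('a word list \<Rightarrow> 'a word) \<Rightarrow> bool" where
  "polytime n F \<longleftrightarrow> (\<exists>M (p :: nat poly). wf_tm M \<and> n < num_tapes M \<and>
    (\<forall>ws. length ws = n \<longrightarrow> halts_within M ws (poly p (sum_list (map length ws))) (F ws)))"

section \<open>Operators, typing and safety\<close>

definition neutral :: "('f \<Rightarrow> nat) \<Rightarrow> ('f \<Rightarrow> 'a::zero_neq_one word list \<Rightarrow> 'a word) \<Rightarrow> 'f \<Rightarrow> bool" where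
  "neutral ar sem f \<longleftrightarrow> ar f = 0
    \<or> (\<forall>ws. length ws = ar f \<longrightarrow> sem f ws \<in> {[0], [1]})
    \<or> (\<forall>ws. length ws = ar f \<longrightarrow> (\<exists>i<ar f. sublist (sem f ws) (ws ! i)))"

text \<open>The 0 only matters for nullary operators, where the maximum is over the empty set.\<close>

definition positive :: "('f \<Rightarrow> nat) \<Rightarrow> ('f \<Rightarrow> 'a word list \<Rightarrow> 'a word) \<Rightarrow> 'f \<Rightarrow> bool" where
  "positive ar sem f \<longleftrightarrow> (\<exists>c::nat. \<forall>ws. length ws = ar f \<longrightarrow>
    length (sem f ws) \<le> Max (insert 0 (length ` set ws)) + c)"

type_synonym 'v var_env = "'v \<Rightarrow> nat"

text \<open>The pair \<open>([t1, \<dots>, tn], t)\<close> stands for the type \<open>t1 \<rightarrow> \<dots> \<rightarrow> tn \<rightarrow> t\<close>.\<close>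

type_synonym 'f op_env = "'f \<Rightarrow> nat \<Rightarrow> (nat list \<times> nat) set"

definition wf_op_env :: "('f \<Rightarrow> nat) \<Rightarrow> 'f op_env \<Rightarrow> bool" where
  "wf_op_env ar \<Delta> \<longleftrightarrow> (\<forall>f t_in. \<forall>(ts, t) \<in> \<Delta> f t_in. length ts = ar f)"

text \<open>A triple \<open>(t, t_in, t_out)\<close> consists of the tier, the innermost tier and the outermost tier.\<close>

inductive type_expr ::
  "('f \<Rightarrow> nat) \<Rightarrow> 'v var_env \<Rightarrow> 'f op_env \<Rightarrow> ('v, 'f) expr \<Rightarrow> nat \<times> nat \<times> nat \<Rightarrow> bool"
  for ar \<Gamma> \<Delta> where
  V: "type_expr ar \<Gamma> \<Delta> (Var x) (\<Gamma> x, t_in, t_out)"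
| OP: "(ts, t) \<in> \<Delta> f t_in \<Longrightarrow> length es = ar f \<Longrightarrow> length ts = ar f \<Longrightarrow>
    (\<And>i. i < ar f \<Longrightarrow> type_expr ar \<Gamma> \<Delta> (es ! i) (ts ! i, t_in, t_out)) \<Longrightarrow>
    type_expr ar \<Gamma> \<Delta> (Op f es) (t, t_in, t_out)"
| OR: "type_expr ar \<Gamma> \<Delta> e1 (t, t_in, t_out) \<Longrightarrow> type_expr ar \<Gamma> \<Delta> e2 (t_out, t_in, t_out) \<Longrightarrow>
    t < t_in \<Longrightarrow> t \<le> t_out \<Longrightarrow> type_expr ar \<Gamma> \<Delta> (Oracle e1 e2) (t, t_in, t_out)"

inductive type_com ::
  "('f \<Rightarrow> nat) \<Rightarrow> 'v var_env \<Rightarrow> 'f op_env \<Rightarrow> ('v, 'f) com \<Rightarrow> nat \<times> nat \<times> nat \<Rightarrow> bool"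
  for ar \<Gamma> \<Delta> where
  SUB: "type_com ar \<Gamma> \<Delta> c (t, t_in, t_out) \<Longrightarrow> type_com ar \<Gamma> \<Delta> c (t + 1, t_in, t_out)"
| SK: "type_com ar \<Gamma> \<Delta> Skip (0, t_in, t_out)"
| A: "type_expr ar \<Gamma> \<Delta> (Var x) (t1, t_in, t_out) \<Longrightarrow> type_expr ar \<Gamma> \<Delta> e (t2, t_in, t_out) \<Longrightarrow>
    t1 \<le> t2 \<Longrightarrow> type_com ar \<Gamma> \<Delta> (Assign x e) (t1, t_in, t_out)"
| S: "type_com ar \<Gamma> \<Delta> c1 \<tau> \<Longrightarrow> type_com ar \<Gamma> \<Delta> c2 \<tau> \<Longrightarrow> type_com ar \<Gamma> \<Delta> (Seq c1 c2) \<tau>"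
| C: "type_expr ar \<Gamma> \<Delta> e \<tau> \<Longrightarrow> type_com ar \<Gamma> \<Delta> c1 \<tau> \<Longrightarrow> type_com ar \<Gamma> \<Delta> c0 \<tau> \<Longrightarrow>
    type_com ar \<Gamma> \<Delta> (Cond e c1 c0) \<tau>"
| W: "type_expr ar \<Gamma> \<Delta> e (t, t_in, t_out) \<Longrightarrow> type_com ar \<Gamma> \<Delta> c (t, t, t_out) \<Longrightarrow>
    1 \<le> t \<Longrightarrow> t \<le> t_out \<Longrightarrow> type_com ar \<Gamma> \<Delta> (While e c) (t, t_in, t_out)"
| W0: "type_expr ar \<Gamma> \<Delta> e (t, t_in, t) \<Longrightarrow> type_com ar \<Gamma> \<Delta> c (t, t, t) \<Longrightarrow>
    1 \<le> t \<Longrightarrow> type_com ar \<Gamma> \<Delta> (While e c) (t, t_in, 0)"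

definition safe_op_env ::
  "('f \<Rightarrow> nat) \<Rightarrow> ('f \<Rightarrow> 'a::zero_neq_one word list \<Rightarrow> 'a word) \<Rightarrow> 'f op_env \<Rightarrow> bool" where
  "safe_op_env ar sem \<Delta> \<longleftrightarrow> (\<forall>f. ar f > 0 \<and> (\<exists>t_in. \<Delta> f t_in \<noteq> {}) \<longrightarrow>
    (neutral ar sem f \<or> positive ar sem f) \<and> polytime (ar f) (sem f) \<and>
    (\<forall>t_in. \<forall>(ts, t) \<in> \<Delta> f t_in.
      t \<le> Min (set ts) \<and> Min (set ts) \<le> Max (set ts) \<and> Max (set ts) \<le> t_in \<and>
      (positive ar sem f \<and> \<not> neutral ar sem f \<longrightarrow> t < t_in)))"

fun safe_prog ::
  "('f \<Rightarrow> nat) \<Rightarrow> ('f \<Rightarrow> 'a::zero_neq_one word list \<Rightarrow> 'a word) \<Rightarrow> 'v var_env \<Rightarrow> 'f op_env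
    \<Rightarrow> ('v, 'f) prog \<Rightarrow> bool" where
  "safe_prog ar sem \<Gamma> \<Delta> (Return c x) \<longleftrightarrow>
    safe_op_env ar sem \<Delta> \<and> (\<exists>t t_in t_out. type_com ar \<Gamma> \<Delta> c (t, t_in, t_out))"

end

theory Submission
  imports Defs "HOL-Library.FuncSet"
begin

text \<open>
  In the body of a loop of tier \<open>t\<close>, variables of tier at least \<open>t\<close> are only modified by neutral
  operators, hence hold factors of their initial values or of constants, and by noninterference they
  evolve independently of the lower tiers. A terminating loop cannot visit the same values twice, so
  its number of iterations is polynomial in the size of the tiers from \<open>t\<close> on. Positive operators
  and oracle answers only enlarge tiers below that of every enclosing loop, so the growth of each
  tier is additive and polynomially bounded in the sizes of the strictly higher tiers; this property
  is stable under sequencing and, by downward induction on tiers, under loops.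
\<close>

section \<open>Polynomials with natural coefficients\<close>

text \<open>The additive form of the growth bounds is forced by loops. Iterating even a bound such
  as \<open>2 * level k\<close> polynomially often gives exponential growth, whereas an increment
  \<open>p (level (k + 1))\<close> is merely multiplied by the number of iterations once the higher
  tiers are under control. A loop then needs only as many polynomial compositions as its tier
  allows, a number fixed by the program. Tier sizes are maxima of lengths rather than sums: copying
  a word within a tier then costs nothing, and a maximum plus a constant is exactly what positive
  operators guarantee. A second obstacle is that the polynomial must not depend on the oracle,
  although answers are bounded only for the calls of the derivation at hand. All bounds are
  therefore proved for globally bounded oracles, uniformly in the bound \<open>B\<close>, which
  enters every tier size as one more candidate for the maximum.\<close>

lemma poly_nat_mono:
  fixes p :: "nat poly"
  assumes "x \<le> y"
  shows "poly p x \<le> poly p y"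
  using assms by (induction p) (auto intro!: add_mono mult_mono)

text \<open>Here \<open>f i k\<close> plays the size of tier \<open>k\<close> after \<open>i\<close>
  rounds. Below \<open>T\<close> the tiers are treated in descending order: once tier
  \<open>k + 1\<close> is bounded in all rounds by its initial size, tier \<open>k\<close> receives
  at most \<open>N\<close> increments of bounded size. Since \<open>q\<close> is chosen before
  \<open>f\<close> and \<open>N\<close>, one polynomial serves all runs. Antitonicity starts at
  index 1, leaving index 0 free for a quantity that is not a tier size.\<close>

lemma poly_iteration_growth:
  fixes p P :: "nat poly" and T K :: nat
  assumes "1 \<le> T"
  shows "\<exists>q :: nat poly. \<forall>(f :: nat \<Rightarrow> nat \<Rightarrow> nat) N.
    (\<forall>a b. 1 \<le> a \<and> a \<le> b \<longrightarrow> f 0 b \<le> f 0 a) \<longrightarrow>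
    (\<forall>i<N. \<forall>k. f (Suc i) k \<le> f i k + poly p (f i (Suc k))) \<longrightarrow>
    (\<forall>i\<le>N. \<forall>k\<ge>T. f i k \<le> f 0 k + K) \<longrightarrow>
    N \<le> poly P (f 0 T) \<longrightarrow>
    (\<forall>i\<le>N. \<forall>k. f i k \<le> f 0 k + poly q (f 0 (Suc k)))"
proof -
  have "\<exists>q :: nat poly. \<forall>(f :: nat \<Rightarrow> nat \<Rightarrow> nat) N.
    (\<forall>a b. 1 \<le> a \<and> a \<le> b \<longrightarrow> f 0 b \<le> f 0 a) \<longrightarrow>
    (\<forall>i<N. \<forall>k. f (Suc i) k \<le> f i k + poly p (f i (Suc k))) \<longrightarrow>
    (\<forall>i\<le>N. \<forall>k\<ge>T. f i k \<le> f 0 k + K) \<longrightarrow>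
    N \<le> poly P (f 0 T) \<longrightarrow>
    (\<forall>i\<le>N. \<forall>k. T \<le> k + j \<longrightarrow> f i k \<le> f 0 k + poly q (f 0 (Suc k)))" for j
  proof (induction j)
    case 0
    show ?case by (rule exI[of _ "[:K:]"]) auto
  next
    case (Suc j)
    then obtain q :: "nat poly" where q: "\<And>(f :: nat \<Rightarrow> nat \<Rightarrow> nat) N.
      (\<forall>a b. 1 \<le> a \<and> a \<le> b \<longrightarrow> f 0 b \<le> f 0 a) \<Longrightarrow>
      (\<forall>i<N. \<forall>k. f (Suc i) k \<le> f i k + poly p (f i (Suc k))) \<Longrightarrow>
      (\<forall>i\<le>N. \<forall>k\<ge>T. f i k \<le> f 0 k + K) \<Longrightarrow>
      N \<le> poly P (f 0 T) \<Longrightarrow>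
      (\<forall>i\<le>N. \<forall>k. T \<le> k + j \<longrightarrow> f i k \<le> f 0 k + poly q (f 0 (Suc k)))"
      by blast
    \<comment> \<open>With \<open>y\<close> the initial size of tier \<open>k + 1\<close>, that tier
      stays below \<open>y + poly q y\<close>, so each of the at most \<open>poly P y\<close> rounds
      adds at most \<open>poly p (y + poly q y)\<close>. The summand \<open>q\<close> covers the
      tiers already treated.\<close>
    let ?q = "q + P * (p \<circ>\<^sub>p ([:0, 1:] + q))"
    show ?case
    proof (rule exI[of _ ?q], intro allI impI)
      fix f :: "nat \<Rightarrow> nat \<Rightarrow> nat" and N i k
      assume anti: "\<forall>a b. 1 \<le> a \<and> a \<le> b \<longrightarrow> f 0 b \<le> f 0 a"
        and step: "\<forall>i<N. \<forall>k. f (Suc i) k \<le> f i k + poly p (f i (Suc k))"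
        and top: "\<forall>i\<le>N. \<forall>k\<ge>T. f i k \<le> f 0 k + K"
        and N: "N \<le> poly P (f 0 T)"
        and i: "i \<le> N" and k: "T \<le> k + Suc j"
      note IH = q[OF anti step top N, rule_format]
      define y where "y = f 0 (Suc k)"
      show "f i k \<le> f 0 k + poly ?q (f 0 (Suc k))"
      proof (cases "T \<le> k + j")
        case True
        then show ?thesis using IH[OF i, of k] by simp
      next
        case False
        have y': "f 0 (Suc (Suc k)) \<le> y" "f 0 T \<le> y"
          using anti assms False by (auto simp: y_def)
        have bd: "f i' (Suc k) \<le> y + poly q y" if "i' \<le> N" for i'
          using IH[of i' "Suc k"] that k poly_nat_mono[OF y'(1), of q]
          unfolding y_def by fastforce
        have "f i' k \<le> f 0 k + i' * poly p (y + poly q y)" if "i' \<le> N" for i'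
          using that
        proof (induction i')
          case (Suc i')
          then show ?case
            using step[rule_format, of i' k] poly_nat_mono[OF bd[of i'], of p] by simp
        qed simp
        note this[OF i]
        also have "i * poly p (y + poly q y) \<le> poly P y * poly p (y + poly q y)"
          using i N poly_nat_mono[OF y'(2), of P] by (intro mult_right_mono) auto
        also have "f 0 k + \<dots> \<le> f 0 k + poly ?q y"
          by (simp add: poly_pcompose)
        finally show ?thesis by (simp add: y_def)
      qed
    qed
  qed
  from this[of T] show ?thesis by simp
qed

section \<open>Big-step semantics with cost\<close>

text \<open>Undefined variables hold the empty word, so that stores and expression values become
  total.\<close>

definition total_store :: "('v, 'a) store \<Rightarrow> 'v \<Rightarrow> 'a word" where
  "total_store \<mu> x = (case \<mu> x of None \<Rightarrow> [] | Some w \<Rightarrow> w)"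

primrec val :: "('f \<Rightarrow> 'a::zero_neq_one word list \<Rightarrow> 'a word) \<Rightarrow> ('a word \<Rightarrow> 'a word) \<Rightarrow>
    ('v \<Rightarrow> 'a word) \<Rightarrow> ('v, 'f) expr \<Rightarrow> 'a word" where
  "val sem \<phi> \<sigma> (Var x) = \<sigma> x"
| "val sem \<phi> \<sigma> (Op f es) = sem f (map (val sem \<phi> \<sigma>) es)"
| "val sem \<phi> \<sigma> (Oracle e1 e2) = \<phi> (trunc_word (val sem \<phi> \<sigma> e1) (val sem \<phi> \<sigma> e2))"

text \<open>The derivation of an expression follows its syntax tree, so its size depends on neither
  the store nor the oracle.\<close>

primrec expr_nodes :: "('v, 'f) expr \<Rightarrow> nat" where
  "expr_nodes (Var x) = 1"
| "expr_nodes (Op f es) = 1 + sum_list (map expr_nodes es)"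
| "expr_nodes (Oracle e1 e2) = 1 + expr_nodes e1 + expr_nodes e2"

text \<open>\<open>While1\<close> merges the loop node with the node of
  \<open>Seq c (While e c)\<close>, hence its \<open>+ 2\<close>; a loop thereby becomes a plain
  sequence of body executions, with node counts still exact.\<close>

inductive exec :: "('f \<Rightarrow> 'a::zero_neq_one word list \<Rightarrow> 'a word) \<Rightarrow> ('a word \<Rightarrow> 'a word) \<Rightarrow>
    ('v \<Rightarrow> 'a word) \<Rightarrow> ('v, 'f) com \<Rightarrow> ('v \<Rightarrow> 'a word) \<Rightarrow> nat \<Rightarrow> bool"
  for sem \<phi> where
  Skip: "exec sem \<phi> \<sigma> Skip \<sigma> 1"
| Assign: "exec sem \<phi> \<sigma> (Assign x e) (\<sigma>(x := val sem \<phi> \<sigma> e)) (expr_nodes e + 1)"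
| Seq: "exec sem \<phi> \<sigma> c1 \<rho> n1 \<Longrightarrow> exec sem \<phi> \<rho> c2 \<tau> n2 \<Longrightarrow>
    exec sem \<phi> \<sigma> (Seq c1 c2) \<tau> (n1 + n2 + 1)"
| Cond1: "val sem \<phi> \<sigma> e = [1] \<Longrightarrow> exec sem \<phi> \<sigma> c1 \<tau> n \<Longrightarrow>
    exec sem \<phi> \<sigma> (Cond e c1 c0) \<tau> (n + expr_nodes e + 1)"
| Cond0: "val sem \<phi> \<sigma> e = [0] \<Longrightarrow> exec sem \<phi> \<sigma> c0 \<tau> n \<Longrightarrow>
    exec sem \<phi> \<sigma> (Cond e c1 c0) \<tau> (n + expr_nodes e + 1)"
| While0: "val sem \<phi> \<sigma> e = [0] \<Longrightarrow> exec sem \<phi> \<sigma> (While e c) \<sigma> (expr_nodes e + 1)"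
| While1: "val sem \<phi> \<sigma> e = [1] \<Longrightarrow> exec sem \<phi> \<sigma> c \<rho> n1 \<Longrightarrow> exec sem \<phi> \<rho> (While e c) \<tau> n2 \<Longrightarrow>
    exec sem \<phi> \<sigma> (While e c) \<tau> (n1 + n2 + expr_nodes e + 2)"

inductive_cases exec_SkipE: "exec sem \<phi> \<sigma> Skip \<tau> n"
inductive_cases exec_AssignE: "exec sem \<phi> \<sigma> (Assign x e) \<tau> n"
inductive_cases exec_SeqE: "exec sem \<phi> \<sigma> (Seq c1 c2) \<tau> n"
inductive_cases exec_CondE: "exec sem \<phi> \<sigma> (Cond e c1 c0) \<tau> n"
inductive_cases exec_WhileE: "exec sem \<phi> \<sigma> (While e c) \<tau> n"

lemma exec_While_states:
  assumes "exec sem \<phi> \<sigma> (While e c) \<tau> n"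
  shows "\<exists>N s m. s 0 = \<sigma> \<and> s N = \<tau> \<and> val sem \<phi> (s N) e = [0] \<and>
    (\<forall>i<N. val sem \<phi> (s i) e = [1] \<and> exec sem \<phi> (s i) c (s (Suc i)) (m i)) \<and>
    n = (\<Sum>i<N. m i + expr_nodes e + 2) + expr_nodes e + 1"
  using assms
proof (induction \<sigma> "While e c" \<tau> n rule: exec.induct)
  case (While0 \<sigma>)
  then show ?case by (intro exI[of _ 0] exI[of _ "\<lambda>_. \<sigma>"]) auto
next
  case (While1 \<sigma> \<rho> n1 \<tau> n2)
  then obtain N s m where IH: "s 0 = \<rho>" "s N = \<tau>" "val sem \<phi> (s N) e = [0]"
    "\<forall>i<N. val sem \<phi> (s i) e = [1] \<and> exec sem \<phi> (s i) c (s (Suc i)) (m i)"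
    "n2 = (\<Sum>i<N. m i + expr_nodes e + 2) + expr_nodes e + 1"
    by blast
  show ?case
    using While1 IH
    by (intro exI[of _ "Suc N"] exI[of _ "case_nat \<sigma> s"] exI[of _ "case_nat n1 m"])
      (auto simp: sum.lessThan_Suc_shift less_Suc_eq_0_disj
        simp del: sum.lessThan_Suc)
qed

text \<open>Replacing overlong answers by the empty word leaves a derivation unchanged as long as its
  own answers are short, and makes the oracle globally bounded.\<close>

definition cap :: "nat \<Rightarrow> ('a word \<Rightarrow> 'a word) \<Rightarrow> 'a word \<Rightarrow> 'a word" where
  "cap B \<phi> w = (if length (\<phi> w) \<le> B then \<phi> w else [])"

section \<open>From derivation trees to executions with cost\<close>

lemma oracle_answers_subtree:
  "\<pi> \<in> set \<pi>s \<Longrightarrow> oracle_answers \<pi> \<subseteq> oracle_answers (Infer J \<pi>s)"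
  by (fastforce simp: oracle_answers_def)

lemma finite_set_ptree: "finite (set_ptree \<pi>)"
  by (induction \<pi>) auto

text \<open>Makes the \<open>Max\<close> in \<open>max_size\<close> a genuine upper bound.\<close>

lemma finite_oracle_answers: "finite (oracle_answers \<pi>)"
proof (rule finite_subset)
  show "oracle_answers \<pi> \<subseteq> (\<lambda>J. case J of EvalE _ _ w \<Rightarrow> w) ` set_ptree \<pi>"
    by (force simp: oracle_answers_def)
qed (simp add: finite_set_ptree)

lemma derivation_expr:
  assumes "derivation ar sem \<phi> \<pi>" "concl \<pi> = EvalE \<mu> e w"
    and "\<forall>w\<in>oracle_answers \<pi>. length w \<le> B"
  shows "w = val sem (cap B \<phi>) (total_store \<mu>) e \<and> num_nodes \<pi> = expr_nodes e"
  using assms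
proof (induction arbitrary: \<mu> e w rule: derivation.induct)
  case (1 \<pi>s J)
  have IH: "w' = val sem (cap B \<phi>) (total_store \<mu>) e' \<and> num_nodes \<pi>' = expr_nodes e'"
    if "\<pi>' \<in> set \<pi>s" "concl \<pi>' = EvalE \<mu> e' w'" for \<pi>' e' w'
    using "1.IH"[OF that] "1.prems"(2) oracle_answers_subtree[OF that(1)] by blast
  from "1.hyps"(1) "1.prems"(1) show ?case
  proof (cases rule: rule_instance.cases)
    case (Op es f ws \<mu>')
    then have J: "e = Op f es" "w = sem f ws" "\<mu>' = \<mu>" using "1.prems"(1) by auto
    have len: "length \<pi>s = length es" "length ws = length es"
      using Op(1,3,4) by (metis length_map length_zip min.idem) (use Op in simp)
    have nth: "ws ! i = val sem (cap B \<phi>) (total_store \<mu>) (es ! i) \<and>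
        num_nodes (\<pi>s ! i) = expr_nodes (es ! i)" if "i < length es" for i
    proof (rule IH)
      show "\<pi>s ! i \<in> set \<pi>s" using that len by simp
      have "map concl \<pi>s ! i = map2 (EvalE \<mu>') es ws ! i" using Op by simp
      then show "concl (\<pi>s ! i) = EvalE \<mu> (es ! i) (ws ! i)"
        using that len J by simp
    qed
    have "ws = map (val sem (cap B \<phi>) (total_store \<mu>)) es"
      using nth len by (intro nth_equalityI) auto
    moreover have "map num_nodes \<pi>s = map expr_nodes es"
      using nth len by (intro nth_equalityI) auto
    ultimately show ?thesis using J by simp
  next
    case (Oracle \<mu>' e1 v e2 u)
    then obtain \<pi>1 \<pi>2 where \<pi>: "\<pi>s = [\<pi>1, \<pi>2]"
      by (auto simp: map_eq_Cons_conv)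
    \<comment> \<open>The conclusion of this node is itself one of the oracle answers of the tree,
      so \<open>cap\<close> does not alter it.\<close>
    have "length w \<le> B"
      using "1.prems" Oracle by (force simp: oracle_answers_def)
    then show ?thesis
      using Oracle "1.prems"(1) \<pi> IH[of \<pi>1 e1 v] IH[of \<pi>2 e2 u]
        cap_def[of B \<phi> "trunc_word v u"] by auto
  qed (use "1.prems" in \<open>auto simp: total_store_def\<close>)
qed

lemma derivation_com:
  assumes "derivation ar sem \<phi> \<pi>" "concl \<pi> = EvalC \<mu> c \<mu>'"
    and "\<forall>w\<in>oracle_answers \<pi>. length w \<le> B"
  shows "exec sem (cap B \<phi>) (total_store \<mu>) c (total_store \<mu>') (num_nodes \<pi>)"
  using assms
proof (induction arbitrary: \<mu> c \<mu>' rule: derivation.induct)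
  case (1 \<pi>s J)
  let ?\<phi> = "cap B \<phi>"
  have IH: "exec sem ?\<phi> (total_store \<nu>) d (total_store \<nu>') (num_nodes \<pi>')"
    if "\<pi>' \<in> set \<pi>s" "concl \<pi>' = EvalC \<nu> d \<nu>'" for \<pi>' d \<nu> \<nu>'
    using "1.IH"[OF that] "1.prems"(2) oracle_answers_subtree[OF that(1)] by blast
  have E: "w' = val sem ?\<phi> (total_store \<mu>) e' \<and> num_nodes \<pi>' = expr_nodes e'"
    if "\<pi>' \<in> set \<pi>s" "concl \<pi>' = EvalE \<mu> e' w'" for \<pi>' e' w'
    using derivation_expr[OF "1.hyps"(2)[OF that(1)] that(2)] "1.prems"(2)
      oracle_answers_subtree[OF that(1)] by blast
  from "1.hyps"(1) "1.prems"(1) show ?case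
  proof (cases rule: rule_instance.cases)
    case Skip
    then show ?thesis using "1.prems"(1) exec.Skip[of sem ?\<phi> "total_store \<mu>"] by auto
  next
    case (Assign \<nu> e w x)
    then obtain \<pi>1 where \<pi>: "\<pi>s = [\<pi>1]" "concl \<pi>1 = EvalE \<mu> e w"
      using "1.prems"(1) by (auto simp: map_eq_Cons_conv)
    have "total_store (\<mu>(x \<mapsto> w)) = (total_store \<mu>)(x := w)"
      by (auto simp: total_store_def)
    then show ?thesis
      using Assign "1.prems"(1) \<pi> E[of \<pi>1 e w] exec.Assign[of sem ?\<phi> "total_store \<mu>" x e]
      by (auto simp: fun_upd_def)
  next
    case (Seq \<nu> c1 \<mu>1 c2 \<mu>2)
    then obtain \<pi>1 \<pi>2 where \<pi>: "\<pi>s = [\<pi>1, \<pi>2]" "concl \<pi>1 = EvalC \<mu> c1 \<mu>1" "concl \<pi>2 = EvalC \<mu>1 c2 \<mu>'"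
      using "1.prems"(1) by (auto simp: map_eq_Cons_conv)
    then show ?thesis
      using exec.Seq[OF IH[OF _ \<pi>(2)] IH[OF _ \<pi>(3)]] Seq "1.prems"(1) by simp
  next
    case (Cond1 \<nu> e c1 \<nu>' c0)
    then obtain \<pi>1 \<pi>2 where \<pi>: "\<pi>s = [\<pi>1, \<pi>2]" "concl \<pi>1 = EvalE \<mu> e [1]" "concl \<pi>2 = EvalC \<mu> c1 \<mu>'"
      using "1.prems"(1) by (auto simp: map_eq_Cons_conv)
    then show ?thesis
      using exec.Cond1[OF _ IH[OF _ \<pi>(3)], of e c0] E[OF _ \<pi>(2)] Cond1 "1.prems"(1)
      by (simp add: add.commute add.left_commute)
  next
    case (Cond0 \<nu> e c0 \<nu>' c1)
    then obtain \<pi>1 \<pi>2 where \<pi>: "\<pi>s = [\<pi>1, \<pi>2]" "concl \<pi>1 = EvalE \<mu> e [0]" "concl \<pi>2 = EvalC \<mu> c0 \<mu>'"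
      using "1.prems"(1) by (auto simp: map_eq_Cons_conv)
    then show ?thesis
      using exec.Cond0[OF _ IH[OF _ \<pi>(3)], of e c1] E[OF _ \<pi>(2)] Cond0 "1.prems"(1)
      by (simp add: add.commute add.left_commute)
  next
    case (While0 \<nu> e d)
    then obtain \<pi>1 where \<pi>: "\<pi>s = [\<pi>1]" "concl \<pi>1 = EvalE \<mu> e [0]"
      using "1.prems"(1) by (auto simp: map_eq_Cons_conv)
    then show ?thesis
      using exec.While0[of sem ?\<phi> "total_store \<mu>" e d] E[OF _ \<pi>(2)] While0 "1.prems"(1) by simp
  next
    case (While1 \<nu> e d \<nu>')
    then obtain \<pi>1 \<pi>2 where \<pi>: "\<pi>s = [\<pi>1, \<pi>2]" "concl \<pi>1 = EvalE \<mu> e [1]"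
      "concl \<pi>2 = EvalC \<mu> (Seq d (While e d)) \<mu>'"
      using "1.prems"(1) by (auto simp: map_eq_Cons_conv)
    \<comment> \<open>The second premise speaks of \<open>Seq d (While e d)\<close>; splitting its
      execution exposes the extra node that \<open>exec.While1\<close> counts.\<close>
    from IH[OF _ \<pi>(3)] \<pi>(1) obtain \<rho> n1 n2
      where "exec sem ?\<phi> (total_store \<mu>) d \<rho> n1" "exec sem ?\<phi> \<rho> (While e d) (total_store \<mu>') n2"
        "num_nodes \<pi>2 = n1 + n2 + 1"
      by (auto elim: exec_SeqE)
    then show ?thesis
      using exec.While1[of sem ?\<phi> "total_store \<mu>" e d \<rho> n1 "total_store \<mu>'" n2]
        E[OF _ \<pi>(2)] \<pi>(1) While1 "1.prems"(1)
      by (simp add: add.commute add.left_commute)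
  qed (use "1.prems" in auto)
qed

section \<open>Inversion of typing\<close>

text \<open>\<open>SUB\<close> may have raised the tier of the command above that of the assigned
  variable, so only an inequality can be recovered.\<close>

lemma type_com_Assign:
  assumes "type_com ar \<Gamma> \<Delta> (Assign x e) (t, t_in, t_out)"
  shows "\<Gamma> x \<le> t \<and> (\<exists>t2\<ge>\<Gamma> x. type_expr ar \<Gamma> \<Delta> e (t2, t_in, t_out))"
  using assms
  by (induction "Assign x e" "(t, t_in, t_out)" arbitrary: t rule: type_com.induct)
    (auto elim: type_expr.cases)

lemma type_com_Seq:
  assumes "type_com ar \<Gamma> \<Delta> (Seq c1 c2) (t, t_in, t_out)"
  shows "type_com ar \<Gamma> \<Delta> c1 (t, t_in, t_out) \<and> type_com ar \<Gamma> \<Delta> c2 (t, t_in, t_out)"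
  using assms
  by (induction "Seq c1 c2" "(t, t_in, t_out)" arbitrary: t rule: type_com.induct)
    (auto intro: type_com.SUB[simplified])

lemma type_com_Cond:
  assumes "type_com ar \<Gamma> \<Delta> (Cond e c1 c0) (t, t_in, t_out)"
  obtains t' where "t' \<le> t" "type_expr ar \<Gamma> \<Delta> e (t', t_in, t_out)"
    "type_com ar \<Gamma> \<Delta> c1 (t', t_in, t_out)" "type_com ar \<Gamma> \<Delta> c0 (t', t_in, t_out)"
proof -
  have "\<exists>t'\<le>t. type_expr ar \<Gamma> \<Delta> e (t', t_in, t_out) \<and>
    type_com ar \<Gamma> \<Delta> c1 (t', t_in, t_out) \<and> type_com ar \<Gamma> \<Delta> c0 (t', t_in, t_out)"
    using assms
    by (induction "Cond e c1 c0" "(t, t_in, t_out)" arbitrary: t rule: type_com.induct)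
      (blast intro: trans_le_add1 order_refl)+
  then show thesis using that by blast
qed

text \<open>Covers \<open>W\<close> and \<open>W0\<close> at once: \<open>t_out'\<close> is
  \<open>t_out\<close> for the former and the loop's own tier for the latter. The last conclusion
  retypes the loop at the tier of its guard, which is what confinement needs when that tier is
  low.\<close>

lemma type_com_While:
  assumes "type_com ar \<Gamma> \<Delta> (While e c) (t, t_in, t_out)"
  obtains t' t_out' where "t' \<le> t" "type_expr ar \<Gamma> \<Delta> e (t', t_in, t_out')"
    "type_com ar \<Gamma> \<Delta> c (t', t', t_out')" "type_com ar \<Gamma> \<Delta> (While e c) (t', t_in, t_out)"
proof -
  have "\<exists>t'\<le>t. \<exists>t_out'. type_expr ar \<Gamma> \<Delta> e (t', t_in, t_out') \<and>
    type_com ar \<Gamma> \<Delta> c (t', t', t_out') \<and> type_com ar \<Gamma> \<Delta> (While e c) (t', t_in, t_out)"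
    using assms
  proof (induction "While e c" "(t, t_in, t_out)" arbitrary: t rule: type_com.induct)
    case (SUB t)
    then show ?case by (blast intro: trans_le_add1)
  next
    case (W t)
    then show ?case by (blast intro: type_com.W order_refl)
  next
    case (W0 t)
    then have "type_com ar \<Gamma> \<Delta> (While e c) (t, t_in, t_out)"
      using type_com.W0[of ar \<Gamma> \<Delta> e t t_in c] by simp
    then show ?case using W0 by blast
  qed
  then show thesis using that by blast
qed

section \<open>Tier levels and noninterference\<close>

definition upper :: "'v var_env \<Rightarrow> 'v set \<Rightarrow> nat \<Rightarrow> 'v set" where
  "upper \<Gamma> V k = {x \<in> V. k \<le> \<Gamma> x}"

text \<open>Inserting \<open>B\<close> makes every level dominate the oracle answers and keeps the
  maximum defined on tiers without variables. The set \<open>V\<close> will be the finite set of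
  program variables.\<close>

definition level :: "'v var_env \<Rightarrow> 'v set \<Rightarrow> nat \<Rightarrow> ('v \<Rightarrow> 'a word) \<Rightarrow> nat \<Rightarrow> nat" where
  "level \<Gamma> V B \<sigma> k = Max (insert B ((\<lambda>x. length (\<sigma> x)) ` upper \<Gamma> V k))"

lemma finite_upper: "finite V \<Longrightarrow> finite (upper \<Gamma> V k)"
  by (simp add: upper_def)

lemma upper_antimono: "k \<le> l \<Longrightarrow> upper \<Gamma> V l \<subseteq> upper \<Gamma> V k"
  by (auto simp: upper_def)

lemma level_le_iff:
  "finite V \<Longrightarrow> level \<Gamma> V B \<sigma> k \<le> b \<longleftrightarrow> B \<le> b \<and> (\<forall>x\<in>upper \<Gamma> V k. length (\<sigma> x) \<le> b)"
  by (auto simp: level_def finite_upper)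

lemma le_level:
  assumes "finite V"
  shows "B \<le> level \<Gamma> V B \<sigma> k" "x \<in> upper \<Gamma> V k \<Longrightarrow> length (\<sigma> x) \<le> level \<Gamma> V B \<sigma> k"
  using level_le_iff[OF assms, of \<Gamma> B \<sigma> k "level \<Gamma> V B \<sigma> k"] by auto

lemma level_antimono: "finite V \<Longrightarrow> k \<le> l \<Longrightarrow> level \<Gamma> V B \<sigma> l \<le> level \<Gamma> V B \<sigma> k"
  using upper_antimono[of k l \<Gamma> V] by (auto simp: level_le_iff le_level)

lemma finite_set1_expr: "finite (set1_expr e)" and finite_set2_expr: "finite (set2_expr e)"
  by (induction e) auto

lemma finite_set1_com: "finite (set1_com c)" and finite_set2_com: "finite (set2_com c)"
  by (induction c) (auto simp: finite_set1_expr finite_set2_expr)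

context
  fixes ar :: "'f \<Rightarrow> nat"
    and sem :: "'f \<Rightarrow> 'a::{finite, zero_neq_one} word list \<Rightarrow> 'a word"
    and \<Gamma> :: "'v var_env" and \<Delta> :: "'f op_env"
  assumes safe: "safe_op_env ar sem \<Delta>"
begin

section \<open>Consequences of operator safety\<close>

lemma safe_typed_op:
  assumes "(ts, t) \<in> \<Delta> f t_in" "ar f > 0"
  shows "neutral ar sem f \<or> positive ar sem f" "t \<le> Min (set ts)"
    "neutral ar sem f \<or> t < t_in"
proof -
  have f: "neutral ar sem f \<or> positive ar sem f"
    and types: "\<forall>t_in. \<forall>(ts, t)\<in>\<Delta> f t_in. t \<le> Min (set ts) \<and>
      Min (set ts) \<le> Max (set ts) \<and> Max (set ts) \<le> t_in \<and>
      (positive ar sem f \<and> \<not> neutral ar sem f \<longrightarrow> t < t_in)"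
    using safe[unfolded safe_op_env_def] assms by blast+
  show "neutral ar sem f \<or> positive ar sem f" by (fact f)
  show "t \<le> Min (set ts)" "neutral ar sem f \<or> t < t_in"
    using types[rule_format, OF assms(1)] f by auto
qed

lemma safe_tiers:
  assumes "(ts, t) \<in> \<Delta> f t_in" "length ts = ar f" "i < ar f"
  shows "t \<le> ts ! i"
  using order_trans[OF safe_typed_op(2)[OF assms(1)] Min_le[of "set ts" "ts ! i"]] assms(2,3)
  by simp

text \<open>Only operators with result tier strictly below the innermost tier may be positive
  without being neutral; nullary ones are neutral by definition.\<close>

lemma safe_neutral:
  assumes "(ts, t) \<in> \<Delta> f t_in" "t_in \<le> t"
  shows "neutral ar sem f"
  using safe_typed_op(3)[OF assms(1)] assms(2) by (cases "ar f = 0") (auto simp: neutral_def)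

lemma safe_op_growth:
  assumes "(ts, t) \<in> \<Delta> f t_in"
  shows "\<exists>c. \<forall>ws b. length ws = ar f \<longrightarrow> (\<forall>w\<in>set ws. length w \<le> b) \<longrightarrow> length (sem f ws) \<le> b + c"
proof -
  consider "ar f = 0" | "ar f > 0" "positive ar sem f" | "ar f > 0" "neutral ar sem f"
    using safe_typed_op(1)[OF assms] by blast
  then show ?thesis
  proof cases
    case 1
    then show ?thesis by (intro exI[of _ "length (sem f [])"]) auto
  next
    case 2
    then obtain c where c: "\<And>ws. length ws = ar f \<Longrightarrow>
        length (sem f ws) \<le> Max (insert 0 (length ` set ws)) + c"
      by (auto simp: positive_def)
    show ?thesis
    proof (intro exI[of _ c] allI impI)
      fix ws :: "'a word list" and b
      assume "length ws = ar f" and b: "\<forall>w\<in>set ws. length w \<le> b"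
      from c[OF this(1)] have "length (sem f ws) \<le> Max (insert 0 (length ` set ws)) + c" .
      moreover have "Max (insert 0 (length ` set ws)) \<le> b" using b by auto
      ultimately show "length (sem f ws) \<le> b + c" by linarith
    qed
  next
    case 3
    show ?thesis
    \<comment> \<open>The constant 1 is for the truth values, which have length 1 even if all
      arguments are empty.\<close>
    proof (intro exI[of _ 1] allI impI)
      fix ws :: "'a word list" and b
      assume ws: "length ws = ar f" and b: "\<forall>w\<in>set ws. length w \<le> b"
      then have "sem f ws \<in> {[0], [1]} \<or> (\<exists>i<ar f. sublist (sem f ws) (ws ! i))"
        using 3 by (auto simp: neutral_def)
      then show "length (sem f ws) \<le> b + 1"
      proof
        assume "\<exists>i<ar f. sublist (sem f ws) (ws ! i)"
        then obtain i where i: "i < ar f" "sublist (sem f ws) (ws ! i)" by blast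
        then have "length (sem f ws) \<le> length (ws ! i)" by (intro sublist_length_le)
        also have "\<dots> \<le> b" using b i ws by simp
        finally show ?thesis by simp
      qed auto
    qed
  qed
qed

text \<open>Arguments of an operator have at least the tier of its result, so their levels are
  dominated by the level of the result, and only constants accumulate. An oracle answer is at most
  \<open>B\<close>, hence below every level.\<close>

lemma expr_growth:
  assumes "type_expr ar \<Gamma> \<Delta> e \<tau>" "set1_expr e \<subseteq> V" "finite V"
  shows "\<exists>C. \<forall>\<phi> B \<sigma>. (\<forall>w. length (\<phi> w) \<le> B) \<longrightarrow>
    length (val sem \<phi> \<sigma> e) \<le> level \<Gamma> V B \<sigma> (fst \<tau>) + C"
  using assms
proof (induction rule: type_expr.induct)
  case (V x t_in t_out)
  then show ?case
    by (intro exI[of _ 0]) (auto intro!: le_level simp: upper_def)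
next
  case (OP ts t f t_in es t_out)
  have "\<forall>i\<in>{..<ar f}. \<exists>C. \<forall>\<phi> B \<sigma>. (\<forall>w. length (\<phi> w) \<le> B) \<longrightarrow>
      length (val sem \<phi> \<sigma> (es ! i)) \<le> level \<Gamma> V B \<sigma> (ts ! i) + C"
  proof
    fix i assume "i \<in> {..<ar f}"
    then have i: "i < ar f" by simp
    then have "set1_expr (es ! i) \<subseteq> V" using OP by (auto simp: UN_subset_iff)
    from OP.IH[OF i this \<open>finite V\<close>]
    show "\<exists>C. \<forall>\<phi> B \<sigma>. (\<forall>w. length (\<phi> w) \<le> B) \<longrightarrow>
      length (val sem \<phi> \<sigma> (es ! i)) \<le> level \<Gamma> V B \<sigma> (ts ! i) + C" by simp
  qed
  from bchoice[OF this] obtain C where "\<forall>i\<in>{..<ar f}. \<forall>\<phi> B \<sigma>. (\<forall>w. length (\<phi> w) \<le> B) \<longrightarrow>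
      length (val sem \<phi> \<sigma> (es ! i)) \<le> level \<Gamma> V B \<sigma> (ts ! i) + C i" ..
  then have C: "length (val sem \<phi> \<sigma> (es ! i)) \<le> level \<Gamma> V B \<sigma> (ts ! i) + C i"
    if "i < ar f" "\<forall>w. length (\<phi> w) \<le> B" for i \<phi> B \<sigma>
    using that by blast
  obtain c where c: "\<And>ws b. length ws = ar f \<Longrightarrow> \<forall>w\<in>set ws. length w \<le> b \<Longrightarrow>
      length (sem f ws) \<le> b + c"
    using safe_op_growth[OF OP.hyps(1)] by blast
  show ?case
  proof (intro exI[of _ "(\<Sum>i<ar f. C i) + c"] allI impI)
    fix \<phi> :: "'a word \<Rightarrow> 'a word" and B \<sigma> assume \<phi>: "\<forall>w. length (\<phi> w) \<le> B"
    have "length (val sem \<phi> \<sigma> (es ! i)) \<le> level \<Gamma> V B \<sigma> t + (\<Sum>i<ar f. C i)" if i: "i < ar f" for i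
    proof -
      have "level \<Gamma> V B \<sigma> (ts ! i) \<le> level \<Gamma> V B \<sigma> t"
        using OP i by (intro level_antimono safe_tiers)
      moreover have "C i \<le> (\<Sum>i<ar f. C i)"
        using i by (intro member_le_sum) auto
      ultimately show ?thesis using C[OF i \<phi>, of \<sigma>] by linarith
    qed
    then have "length (sem f (map (val sem \<phi> \<sigma>) es)) \<le> (level \<Gamma> V B \<sigma> t + (\<Sum>i<ar f. C i)) + c"
      using OP by (intro c) (auto simp: all_set_conv_all_nth)
    then show "length (val sem \<phi> \<sigma> (Op f es)) \<le>
        level \<Gamma> V B \<sigma> (fst (t, t_in, t_out)) + ((\<Sum>i<ar f. C i) + c)" by simp
  qed
next
  case (OR e1 t t_in t_out e2)
  show ?case
    using \<open>finite V\<close> by (intro exI[of _ 0]) (auto intro: order_trans le_level)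
qed

text \<open>Tiers never decrease from an expression to its subexpressions. For oracle calls this is
  the side condition \<open>t \<le> t_out\<close> of \<open>OR\<close>, since the second argument
  has tier \<open>t_out\<close>.\<close>

lemma expr_noninterference:
  assumes "type_expr ar \<Gamma> \<Delta> e \<tau>" "k \<le> fst \<tau>" "set1_expr e \<subseteq> V" "\<forall>x\<in>upper \<Gamma> V k. \<sigma> x = \<sigma>' x"
  shows "val sem \<phi> \<sigma> e = val sem \<phi> \<sigma>' e"
  using assms
proof (induction rule: type_expr.induct)
  case (OP ts t f t_in es t_out)
  have "val sem \<phi> \<sigma> (es ! i) = val sem \<phi> \<sigma>' (es ! i)" if i: "i < ar f" for i
  proof (rule OP.IH[OF i])
    show "k \<le> fst (ts ! i, t_in, t_out)"
      using safe_tiers[OF OP.hyps(1,3) i] OP.prems by simp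
    show "set1_expr (es ! i) \<subseteq> V" using OP i by (auto simp: UN_subset_iff)
  qed fact
  then have "map (val sem \<phi> \<sigma>) es = map (val sem \<phi> \<sigma>') es"
    using OP by (intro nth_equalityI) auto
  then show ?case by (simp only: val.simps)
qed (auto simp: upper_def)

text \<open>With innermost tier at most \<open>k\<close> and result tier at least \<open>k\<close>,
  oracle calls are untypable, because \<open>OR\<close> demands \<open>t < t_in\<close>, and every
  operator is neutral. \<open>A\<close> is to be a finite set of words, so that reachable values can
  be counted.\<close>

lemma expr_neutral:
  assumes "type_expr ar \<Gamma> \<Delta> e \<tau>" "k \<le> fst \<tau>" "fst (snd \<tau>) \<le> k" "set1_expr e \<subseteq> V"
    and "\<forall>x\<in>upper \<Gamma> V k. \<sigma> x \<in> A" "[0] \<in> A" "[1] \<in> A" "\<And>v w. w \<in> A \<Longrightarrow> sublist v w \<Longrightarrow> v \<in> A"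
    and "\<And>f. f \<in> set2_expr e \<Longrightarrow> ar f = 0 \<Longrightarrow> sem f [] \<in> A"
  shows "val sem \<phi> \<sigma> e \<in> A"
  using assms
proof (induction rule: type_expr.induct)
  case (OP ts t f t_in es t_out)
  have args: "val sem \<phi> \<sigma> (es ! i) \<in> A" if i: "i < ar f" for i
  proof (rule OP.IH[OF i])
    show "k \<le> fst (ts ! i, t_in, t_out)"
      using safe_tiers[OF OP.hyps(1,3) i] OP.prems by simp
    show "set1_expr (es ! i) \<subseteq> V" using OP i by (auto simp: UN_subset_iff)
    show "sem g [] \<in> A" if "g \<in> set2_expr (es ! i)" "ar g = 0" for g
    proof (rule OP.prems(8))
      show "g \<in> set2_expr (Op f es)" using that OP.hyps i by auto
    qed (fact that)
  qed (use OP.prems in auto)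
  have "neutral ar sem f"
    using safe_neutral[OF OP.hyps(1)] OP.prems by simp
  then have "ar f = 0 \<or> sem f (map (val sem \<phi> \<sigma>) es) \<in> {[0], [1]} \<or>
      (\<exists>i<ar f. sublist (sem f (map (val sem \<phi> \<sigma>) es)) (map (val sem \<phi> \<sigma>) es ! i))"
    using OP.hyps(2) unfolding neutral_def by (metis length_map)
  then show ?case
  proof (elim disjE exE conjE)
    assume "ar f = 0"
    then show ?thesis using OP.prems(8)[of f] OP.hyps(2) by simp
  next
    assume "sem f (map (val sem \<phi> \<sigma>) es) \<in> {[0], [1]}"
    then show ?thesis using OP.prems(5,6) by auto
  next
    fix i assume i: "i < ar f" "sublist (sem f (map (val sem \<phi> \<sigma>) es)) (map (val sem \<phi> \<sigma>) es ! i)"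
    show ?thesis using OP.prems(7)[OF args[OF i(1)]] i OP.hyps(2) by simp
  qed
qed (auto simp: upper_def)

text \<open>Passing to subcommands never raises the tier, and an assignment has at least the tier of
  its variable. A guard of low tier thus cannot influence higher tiers through the choice of a
  branch.\<close>

lemma com_confinement:
  assumes "exec sem \<phi> \<sigma> c \<tau> n" "type_com ar \<Gamma> \<Delta> c (t, t_in, t_out)" "t < \<Gamma> x"
  shows "\<tau> x = \<sigma> x"
  using assms
proof (induction arbitrary: t t_in t_out rule: exec.induct)
  case (Assign \<sigma> y e)
  then show ?case using type_com_Assign[OF Assign(1)] by auto
next
  case (Seq \<sigma> c1 \<rho> n1 c2 \<tau> n2)
  then show ?case using type_com_Seq[OF Seq.prems(1)] by metis
next
  case (Cond1 \<sigma> e c1 \<tau> n c0)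
  from Cond1.prems show ?case by (elim type_com_Cond) (meson Cond1.IH le_less_trans)
next
  case (Cond0 \<sigma> e c0 \<tau> n c1)
  from Cond0.prems show ?case by (elim type_com_Cond) (meson Cond0.IH le_less_trans)
next
  case (While1 \<sigma> e c \<rho> n1 \<tau> n2)
  obtain t' t_out' where "t' \<le> t" "type_com ar \<Gamma> \<Delta> c (t', t', t_out')"
    using While1.prems(1) by (rule type_com_While)
  then show ?case using While1.IH(1)[of t' t' t_out'] While1.IH(2)[OF While1.prems] While1.prems by simp
qed auto

lemma com_noninterference:
  assumes "exec sem \<phi> \<sigma> c \<tau> n" "exec sem \<phi> \<sigma>' c \<tau>' n'" "type_com ar \<Gamma> \<Delta> c (t, t_in, t_out)"
    and "set1_com c \<subseteq> V" "\<forall>x\<in>upper \<Gamma> V k. \<sigma> x = \<sigma>' x"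
  shows "\<forall>x\<in>upper \<Gamma> V k. \<tau> x = \<tau>' x"
proof -
  \<comment> \<open>If the command has tier below \<open>k\<close>, neither run touches
    \<open>upper \<Gamma> V k\<close>, however differently they branch or iterate. In the remaining
    cases the guards agree and both runs proceed in step.\<close>
  have low: "\<forall>x\<in>upper \<Gamma> V k. \<tau> x = \<tau>' x"
    if "exec sem \<phi> \<sigma> c \<tau> n" "exec sem \<phi> \<sigma>' c \<tau>' n'" "type_com ar \<Gamma> \<Delta> c (t, t_in, t_out)"
      "t < k" "\<forall>x\<in>upper \<Gamma> V k. \<sigma> x = \<sigma>' x"
    for \<sigma> \<sigma>' :: "'v \<Rightarrow> 'a word" and c :: "('v, 'f) com" and \<tau> \<tau>' n n' t t_in t_out
  proof
    fix x assume x: "x \<in> upper \<Gamma> V k"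
    then have "t < \<Gamma> x" using that(4) by (simp add: upper_def)
    then have "\<tau> x = \<sigma> x" "\<tau>' x = \<sigma>' x" using that(1-3) by (metis com_confinement)+
    then show "\<tau> x = \<tau>' x" using that(5) x by simp
  qed
  show ?thesis
    using assms
  proof (induction arbitrary: \<sigma>' \<tau>' n' t t_in t_out rule: exec.induct)
    case (Skip \<sigma>)
    then show ?case by (auto elim: exec_SkipE)
  next
    case (Assign \<sigma> y e)
    obtain t2 where t2: "\<Gamma> y \<le> t2" "type_expr ar \<Gamma> \<Delta> e (t2, t_in, t_out)"
      using type_com_Assign[OF Assign(2)] by blast
    have "val sem \<phi> \<sigma> e = val sem \<phi> \<sigma>' e" if "k \<le> \<Gamma> y"
      using expr_noninterference[OF t2(2), of k V \<sigma> \<sigma>'] that t2(1) Assign by simp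
    then show ?case using Assign(1,4) by (auto elim!: exec_AssignE simp: upper_def)
  next
    case (Seq \<sigma> c1 \<rho> n1 c2 \<tau> n2)
    from Seq.prems(1) obtain \<rho>' n1' n2'
      where "exec sem \<phi> \<sigma>' c1 \<rho>' n1'" "exec sem \<phi> \<rho>' c2 \<tau>' n2'" by (elim exec_SeqE)
    moreover have "type_com ar \<Gamma> \<Delta> c1 (t, t_in, t_out)" "type_com ar \<Gamma> \<Delta> c2 (t, t_in, t_out)"
      using type_com_Seq[OF Seq.prems(2)] by auto
    ultimately show ?case using Seq.IH Seq.prems(3,4) by simp
  next
    case (Cond1 \<sigma> e c1 \<tau> n c0)
    from Cond1.prems(2) obtain t' where t': "type_expr ar \<Gamma> \<Delta> e (t', t_in, t_out)"
      "type_com ar \<Gamma> \<Delta> c1 (t', t_in, t_out)" "type_com ar \<Gamma> \<Delta> (Cond e c1 c0) (t', t_in, t_out)"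
      by (elim type_com_Cond) (blast intro: type_com.C)
    show ?case
    proof (cases "t' < k")
      case True
      show ?thesis
        by (rule low[OF exec.Cond1[OF Cond1.hyps] Cond1.prems(1) t'(3) True Cond1.prems(4)])
    next
      case False
      then have "val sem \<phi> \<sigma>' e = [1]"
        using expr_noninterference[OF t'(1), of k V \<sigma> \<sigma>'] Cond1 by simp
      with Cond1.prems(1) obtain m where "exec sem \<phi> \<sigma>' c1 \<tau>' m"
        by (elim exec_CondE) auto
      from Cond1.IH[OF this t'(2)] Cond1.prems show ?thesis by simp
    qed
  next
    case (Cond0 \<sigma> e c0 \<tau> n c1)
    from Cond0.prems(2) obtain t' where t': "type_expr ar \<Gamma> \<Delta> e (t', t_in, t_out)"
      "type_com ar \<Gamma> \<Delta> c0 (t', t_in, t_out)" "type_com ar \<Gamma> \<Delta> (Cond e c1 c0) (t', t_in, t_out)"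
      by (elim type_com_Cond) (blast intro: type_com.C)
    show ?case
    proof (cases "t' < k")
      case True
      show ?thesis
        by (rule low[OF exec.Cond0[OF Cond0.hyps] Cond0.prems(1) t'(3) True Cond0.prems(4)])
    next
      case False
      then have "val sem \<phi> \<sigma>' e = [0]"
        using expr_noninterference[OF t'(1), of k V \<sigma> \<sigma>'] Cond0 by simp
      with Cond0.prems(1) obtain m where "exec sem \<phi> \<sigma>' c0 \<tau>' m"
        by (elim exec_CondE) auto
      from Cond0.IH[OF this t'(2)] Cond0.prems show ?thesis by simp
    qed
  next
    case (While0 \<sigma> e c)
    obtain t' t_out' where t': "type_expr ar \<Gamma> \<Delta> e (t', t_in, t_out')"
      "type_com ar \<Gamma> \<Delta> (While e c) (t', t_in, t_out)"
      using While0.prems(2) by (rule type_com_While)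
    show ?case
    proof (cases "t' < k")
      case True
      show ?thesis
        by (rule low[OF exec.While0[OF While0.hyps] While0.prems(1) t'(2) True While0.prems(4)])
    next
      case False
      then have "val sem \<phi> \<sigma>' e = [0]"
        using expr_noninterference[OF t'(1), of k V \<sigma> \<sigma>'] While0 by simp
      with While0.prems(1) have "\<tau>' = \<sigma>'" by - (erule exec_WhileE, auto)
      then show ?thesis using While0.prems(4) by simp
    qed
  next
    case (While1 \<sigma> e c \<rho> n1 \<tau> n2)
    obtain t' t_out' where t': "type_expr ar \<Gamma> \<Delta> e (t', t_in, t_out')"
      "type_com ar \<Gamma> \<Delta> c (t', t', t_out')" "type_com ar \<Gamma> \<Delta> (While e c) (t', t_in, t_out)"
      using While1.prems(2) by (rule type_com_While)
    show ?case
    proof (cases "t' < k")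
      case True
      show ?thesis
        by (rule low[OF exec.While1[OF While1.hyps] While1.prems(1) t'(3) True While1.prems(4)])
    next
      case False
      then have "val sem \<phi> \<sigma>' e = [1]"
        using expr_noninterference[OF t'(1), of k V \<sigma> \<sigma>'] While1 by simp
      with While1.prems(1) obtain \<rho>' m m'
        where \<rho>': "exec sem \<phi> \<sigma>' c \<rho>' m" "exec sem \<phi> \<rho>' (While e c) \<tau>' m'"
        by - (erule exec_WhileE, auto)
      have "\<forall>x\<in>upper \<Gamma> V k. \<rho> x = \<rho>' x"
        using While1.IH(1)[OF \<rho>'(1) t'(2)] While1.prems by simp
      then show ?thesis using While1.IH(2)[OF \<rho>'(2)] While1.prems by blast
    qed
  qed
qed

text \<open>The tier of a nested loop is at most \<open>t\<close> and becomes the innermost tier of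
  its body; bounding both \<open>t\<close> and \<open>t_in\<close> by \<open>k\<close> is therefore
  stable under nesting.\<close>

lemma com_neutral:
  assumes "exec sem \<phi> \<sigma> c \<tau> n" "type_com ar \<Gamma> \<Delta> c (t, t_in, t_out)" "t \<le> k" "t_in \<le> k"
    and "set1_com c \<subseteq> V" "\<And>f. f \<in> set2_com c \<Longrightarrow> ar f = 0 \<Longrightarrow> sem f [] \<in> A"
    and "\<forall>x\<in>upper \<Gamma> V k. \<sigma> x \<in> A"
    and A: "[0] \<in> A" "[1] \<in> A" "\<And>v w. w \<in> A \<Longrightarrow> sublist v w \<Longrightarrow> v \<in> A"
  shows "\<forall>x\<in>upper \<Gamma> V k. \<tau> x \<in> A"
  using assms(1-7)
proof (induction arbitrary: t t_in t_out rule: exec.induct)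
  case (Assign \<sigma> y e)
  obtain t2 where t2: "\<Gamma> y \<le> t2" "type_expr ar \<Gamma> \<Delta> e (t2, t_in, t_out)"
    using type_com_Assign[OF Assign(1)] by blast
  have "val sem \<phi> \<sigma> e \<in> A" if "k \<le> \<Gamma> y"
    by (rule expr_neutral[OF t2(2), of k V]) (use Assign that t2(1) A in auto)
  then show ?case using Assign by (auto simp: upper_def)
next
  case (Seq \<sigma> c1 \<rho> n1 c2 \<tau> n2)
  have "type_com ar \<Gamma> \<Delta> c1 (t, t_in, t_out)" "type_com ar \<Gamma> \<Delta> c2 (t, t_in, t_out)"
    using type_com_Seq[OF Seq.prems(1)] by auto
  then show ?case using Seq.IH Seq.prems by simp
next
  case (Cond1 \<sigma> e c1 \<tau> n c0)
  obtain t' where "t' \<le> t" "type_com ar \<Gamma> \<Delta> c1 (t', t_in, t_out)"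
    using Cond1.prems(1) by (rule type_com_Cond)
  then show ?case using Cond1.IH[of t' t_in t_out] Cond1.prems by simp
next
  case (Cond0 \<sigma> e c0 \<tau> n c1)
  obtain t' where "t' \<le> t" "type_com ar \<Gamma> \<Delta> c0 (t', t_in, t_out)"
    using Cond0.prems(1) by (rule type_com_Cond)
  then show ?case using Cond0.IH[of t' t_in t_out] Cond0.prems by simp
next
  case (While1 \<sigma> e c \<rho> n1 \<tau> n2)
  obtain t' t_out' where "t' \<le> t" "type_com ar \<Gamma> \<Delta> c (t', t', t_out')"
    using While1.prems(1) by (rule type_com_While)
  then have "\<forall>x\<in>upper \<Gamma> V k. \<rho> x \<in> A"
    using While1.IH(1)[of t' t' t_out'] While1.prems by simp
  then show ?case using While1.IH(2)[OF While1.prems(1-5)] by blast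
qed auto

section \<open>Polynomial bounds\<close>

text \<open>Two iterations of a tier \<open>t\<close> loop cannot agree on the tiers from \<open>t\<close> on, as otherwise the
  loop would run forever; and on these tiers only finitely many values are available, namely
  factors of the initial ones.\<close>

lemma While_iterations:
  assumes V: "finite V" "set1_expr e \<subseteq> V" "set1_com c \<subseteq> V"
    and e: "type_expr ar \<Gamma> \<Delta> e (t, t_in, t_out)" and c: "type_com ar \<Gamma> \<Delta> c (t, t, t_out)"
  shows "\<exists>(P :: nat poly) K. \<forall>\<phi> B N s m. val sem \<phi> (s N) e = [0] \<longrightarrow>
    (\<forall>i<N. val sem \<phi> (s i) e = [1] \<and> exec sem \<phi> (s i) c (s (Suc i)) (m i)) \<longrightarrow>
    N \<le> poly P (level \<Gamma> V B (s 0) t) \<and>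
    (\<forall>i\<le>N. \<forall>k\<ge>t. level \<Gamma> V B (s i) k \<le> level \<Gamma> V B (s 0) k + K)"
proof -
  define F where "F = {f \<in> set2_com c. ar f = 0}"
  have F: "finite F" by (simp add: F_def finite_set2_com)
  \<comment> \<open>A reachable word exceeds the initial level by at most \<open>K\<close>: 1 for
    the truth values, the sum for any constant. \<open>D\<close> bounds the number of words whose
    factors are reachable, a word of length at most \<open>x\<close> has at most
    \<open>1 + x * (1 + x)\<close> factors, and \<open>P\<close> counts the assignments of such
    factors to at most \<open>card V\<close> variables.\<close>
  define K where "K = 1 + (\<Sum>f\<in>F. length (sem f []))"
  define D where "D = 2 + card F + card V"
  define P where "P = ([:D:] * (1 + [:K, 1:] * (1 + [:K, 1:]))) ^ card V"
  show ?thesis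
  proof (rule exI[of _ P], rule exI[of _ K], intro allI impI)
    fix \<phi> :: "'a word \<Rightarrow> 'a word" and B N and s :: "nat \<Rightarrow> 'v \<Rightarrow> 'a word" and m
    assume end_loop: "val sem \<phi> (s N) e = [0]"
      and loop: "\<forall>i<N. val sem \<phi> (s i) e = [1] \<and> exec sem \<phi> (s i) c (s (Suc i)) (m i)"
    let ?L = "level \<Gamma> V B (s 0)"
    define S where "S k = {[0], [1]} \<union> (\<lambda>f. sem f []) ` F \<union> s 0 ` upper \<Gamma> V k" for k
    define A where "A k = (\<Union>w\<in>S k. set (sublists w))" for k
    have finS: "finite (S k)" for k using V F by (simp add: S_def finite_upper)
    have finA: "finite (A k)" for k using finS by (simp add: A_def)
    have memA: "v \<in> A k \<longleftrightarrow> (\<exists>w\<in>S k. sublist v w)" for v k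
      by (auto simp: A_def)
    have S_A: "w \<in> S k \<Longrightarrow> w \<in> A k" for w k by (auto simp: memA)
    have A_sub: "w \<in> A k \<Longrightarrow> sublist v w \<Longrightarrow> v \<in> A k" for v w k
      unfolding memA by (meson sublist_order.order_trans)
    \<comment> \<open>Each \<open>k\<close> gets its own set, so that tier \<open>k\<close> is
      compared with its own initial level and not with the larger level of \<open>t\<close>.\<close>
    have in_A: "\<forall>x\<in>upper \<Gamma> V k. s i x \<in> A k" if "i \<le> N" "t \<le> k" for i k
      using that(1)
    proof (induction i)
      case 0
      then show ?case by (auto intro: S_A simp: S_def)
    next
      case (Suc i)
      then have ex: "exec sem \<phi> (s i) c (s (Suc i)) (m i)" using loop by simp
      show ?case
        by (rule com_neutral[OF ex c that(2) that(2) V(3)])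
          (use Suc A_sub in \<open>auto intro: S_A simp: S_def F_def\<close>)
    qed
    have len_S: "length w \<le> ?L k + K" if "w \<in> S k" for w k
    proof -
      have "length (sem f []) \<le> (\<Sum>f\<in>F. length (sem f []))" if "f \<in> F" for f
        using that F by (intro member_le_sum) auto
      then have "length w \<le> K \<or> length w \<le> ?L k"
        using that le_level(2)[OF V(1), of _ \<Gamma> k "s 0" B] by (auto simp: S_def K_def intro: le_SucI)
      then show ?thesis by auto
    qed
    have len_A: "length w \<le> ?L k + K" if "w \<in> A k" for w k
      using that len_S by (auto simp: memA dest!: sublist_length_le intro: order_trans)
    have levels: "level \<Gamma> V B (s i) k \<le> ?L k + K" if "i \<le> N" "t \<le> k" for i k
      using in_A[OF that] len_A le_level(1)[OF V(1), of B \<Gamma> "s 0" k] V(1)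
      by (auto simp: level_le_iff intro: trans_le_add1)

    let ?U = "upper \<Gamma> V t" and ?x = "?L t + K"
    have "card (A t) \<le> (\<Sum>w\<in>S t. card (set (sublists w)))"
      unfolding A_def using finS by (rule card_UN_le)
    also have "\<dots> \<le> (\<Sum>w\<in>S t. 1 + ?x * (1 + ?x))"
    proof (rule sum_mono)
      fix w assume "w \<in> S t"
      then have "length w * Suc (length w) \<le> ?x * (1 + ?x)"
        using len_S[of w t] by (intro mult_mono) auto
      then have "Suc (length w * Suc (length w) div 2) \<le> 1 + ?x * (1 + ?x)"
        using div_le_dividend[of "length w * Suc (length w)" 2] by linarith
      then show "card (set (sublists w)) \<le> 1 + ?x * (1 + ?x)"
        using card_length[of "sublists w"] by (simp only: length_sublists)
    qed
    also have "\<dots> \<le> D * (1 + ?x * (1 + ?x))"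
    proof -
      have "card (S t) \<le> card {[0 :: 'a], [1]} + card ((\<lambda>f. sem f []) ` F) + card (s 0 ` ?U)"
        unfolding S_def by (meson card_Un_le add_le_mono1 order_trans)
      also have "\<dots> \<le> 2 + card F + card ?U"
        using F V(1) by (intro add_mono card_image_le) (auto simp: finite_upper)
      also have "\<dots> \<le> D" using V(1) by (auto simp: D_def upper_def intro: card_mono)
      finally have "card (S t) \<le> D" .
      then show ?thesis unfolding sum_constant of_nat_id by (rule mult_right_mono) simp
    qed
    finally have card_A: "card (A t) \<le> D * (1 + ?x * (1 + ?x))" .

    \<comment> \<open>Shifting both rounds forward by \<open>N - j\<close> carries the agreement to
      the final state, so the guard would already be \<open>[0]\<close> in round
      \<open>i + (N - j) < N\<close>.\<close>
    have distinct: False if ij: "i < j" "j \<le> N" and eq: "\<forall>x\<in>?U. s i x = s j x" for i j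
    proof -
      have "\<forall>x\<in>?U. s (i + d) x = s (j + d) x" if "j + d \<le> N" for d
        using that
      proof (induction d)
        case (Suc d)
        then have "exec sem \<phi> (s (i + d)) c (s (Suc (i + d))) (m (i + d))"
          "exec sem \<phi> (s (j + d)) c (s (Suc (j + d))) (m (j + d))"
          using loop ij by auto
        from com_noninterference[OF this c V(3)] Suc show ?case by simp
      qed (use eq in simp)
      from this[of "N - j"] have "\<forall>x\<in>?U. s (i + (N - j)) x = s N x" using ij by simp
      then have "val sem \<phi> (s (i + (N - j))) e = val sem \<phi> (s N) e"
        by (intro expr_noninterference[OF e _ V(2)]) auto
      moreover have "i + (N - j) < N" using ij by simp
      ultimately show False using loop end_loop by fastforce
    qed
    have inj: "inj_on (\<lambda>i. restrict (s i) ?U) {..N}"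
    proof (rule inj_onI)
      fix i j assume "i \<in> {..N}" "j \<in> {..N}" and eq: "restrict (s i) ?U = restrict (s j) ?U"
      moreover have "\<forall>x\<in>?U. s i x = s j x" using eq by (metis restrict_apply')
      ultimately show "i = j"
        using distinct[of i j] distinct[of j i] by (metis atMost_iff linorder_neqE_nat)
    qed
    \<comment> \<open>Pigeonhole: restricted to \<open>?U\<close>, the \<open>N + 1\<close> states
      are distinct functions into \<open>A t\<close>.\<close>
    have "card {..N} \<le> card (?U \<rightarrow>\<^sub>E A t)"
      using in_A V(1) finA by (intro card_inj_on_le[OF inj] finite_PiE) (auto simp: finite_upper)
    also have "\<dots> = card (A t) ^ card ?U"
      using V(1) by (simp add: card_PiE finite_upper)
    also have "\<dots> \<le> card (A t) ^ card V"
    proof (rule power_increasing)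
      show "card ?U \<le> card V" using V(1) by (auto simp: upper_def intro: card_mono)
      \<comment> \<open>Enlarging the exponent requires a base of at least 1.\<close>
      have "[0] \<in> A t" by (auto intro: S_A simp: S_def)
      then show "1 \<le> card (A t)" using finA[of t] by (auto simp: Suc_le_eq card_gt_0_iff)
    qed
    also have "\<dots> \<le> (D * (1 + ?x * (1 + ?x))) ^ card V"
      using card_A by (rule power_mono) simp
    also have "\<dots> = poly P (?L t)"
      by (simp add: P_def algebra_simps)
    finally show "N \<le> poly P (?L t) \<and> (\<forall>i\<le>N. \<forall>k\<ge>t. level \<Gamma> V B (s i) k \<le> ?L k + K)"
      using levels by simp
  qed
qed

text \<open>The growth of each tier is governed by the strictly higher tiers alone, which is what
  survives iteration.\<close>

lemma com_growth:
  assumes "type_com ar \<Gamma> \<Delta> c (t, t_in, t_out)" "set1_com c \<subseteq> V" and V: "finite V"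
  shows "\<exists>p :: nat poly. \<forall>\<phi> B \<sigma> \<tau> n. (\<forall>w. length (\<phi> w) \<le> B) \<longrightarrow> exec sem \<phi> \<sigma> c \<tau> n \<longrightarrow>
    n \<le> poly p (level \<Gamma> V B \<sigma> 0) \<and>
    (\<forall>k. level \<Gamma> V B \<tau> k \<le> level \<Gamma> V B \<sigma> k + poly p (level \<Gamma> V B \<sigma> (Suc k)))"
  using assms(1,2)
proof (induction c arbitrary: t t_in t_out)
  case Skip
  then show ?case by (intro exI[of _ "[:1:]"]) (auto elim: exec_SkipE)
next
  case (Assign y e)
  obtain t2 where t2: "\<Gamma> y \<le> t2" "type_expr ar \<Gamma> \<Delta> e (t2, t_in, t_out)"
    using type_com_Assign[OF Assign(1)] by blast
  have sub: "set1_expr e \<subseteq> V" using Assign(2) by simp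
  obtain C where "\<forall>\<phi> B \<sigma>. (\<forall>w. length (\<phi> w) \<le> B) \<longrightarrow>
      length (val sem \<phi> \<sigma> e) \<le> level \<Gamma> V B \<sigma> (fst (t2, t_in, t_out)) + C"
    using expr_growth[OF t2(2) sub V] ..
  then have C: "length (val sem \<phi> \<sigma> e) \<le> level \<Gamma> V B \<sigma> t2 + C"
    if "\<forall>w. length (\<phi> w) \<le> B" for \<phi> B \<sigma>
    using that by simp
  show ?case
  proof (intro exI[of _ "[:C + expr_nodes e + 1:]"] allI impI)
    fix \<phi> B \<sigma> \<tau> n assume \<phi>: "\<forall>w. length (\<phi> w) \<le> B" and "exec sem \<phi> \<sigma> (Assign y e) \<tau> n"
    then have \<tau>: "\<tau> = \<sigma>(y := val sem \<phi> \<sigma> e)" "n = expr_nodes e + 1"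
      by (auto elim: exec_AssignE)
    have "length (\<tau> x) \<le> level \<Gamma> V B \<sigma> k + C" if "x \<in> upper \<Gamma> V k" for x k
    proof (cases "x = y")
      case True
      then have "level \<Gamma> V B \<sigma> t2 \<le> level \<Gamma> V B \<sigma> k"
        using that t2(1) by (intro level_antimono[OF V]) (simp add: upper_def)
      then show ?thesis using C[OF \<phi>, of \<sigma>] True \<tau>(1) by simp
    next
      case False
      then show ?thesis using le_level(2)[OF V that, of \<sigma> B] \<tau>(1) by simp
    qed
    then have "level \<Gamma> V B \<tau> k \<le> level \<Gamma> V B \<sigma> k + C" for k
      using le_level(1)[OF V, of B \<Gamma> \<sigma> k] by (auto simp: level_le_iff[OF V] intro: trans_le_add1)
    then show "n \<le> poly [:C + expr_nodes e + 1:] (level \<Gamma> V B \<sigma> 0) \<and>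
      (\<forall>k. level \<Gamma> V B \<tau> k \<le> level \<Gamma> V B \<sigma> k +
        poly [:C + expr_nodes e + 1:] (level \<Gamma> V B \<sigma> (Suc k)))"
      using \<tau>(2) by (auto simp: add.assoc[symmetric] intro: le_SucI trans_le_add1)
  qed
next
  case (Seq c1 c2)
  have ty: "type_com ar \<Gamma> \<Delta> c1 (t, t_in, t_out)" "type_com ar \<Gamma> \<Delta> c2 (t, t_in, t_out)"
    using type_com_Seq[OF Seq.prems(1)] by auto
  have sub: "set1_com c1 \<subseteq> V" "set1_com c2 \<subseteq> V" using Seq.prems(2) by auto
  obtain p1 :: "nat poly" where p1: "\<And>\<phi> B \<sigma> \<tau> n. \<forall>w. length (\<phi> w) \<le> B \<Longrightarrow> exec sem \<phi> \<sigma> c1 \<tau> n \<Longrightarrow>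
    n \<le> poly p1 (level \<Gamma> V B \<sigma> 0) \<and>
    (\<forall>k. level \<Gamma> V B \<tau> k \<le> level \<Gamma> V B \<sigma> k + poly p1 (level \<Gamma> V B \<sigma> (Suc k)))"
    using Seq.IH(1)[OF ty(1) sub(1)] by blast
  obtain p2 :: "nat poly" where p2: "\<And>\<phi> B \<sigma> \<tau> n. \<forall>w. length (\<phi> w) \<le> B \<Longrightarrow> exec sem \<phi> \<sigma> c2 \<tau> n \<Longrightarrow>
    n \<le> poly p2 (level \<Gamma> V B \<sigma> 0) \<and>
    (\<forall>k. level \<Gamma> V B \<tau> k \<le> level \<Gamma> V B \<sigma> k + poly p2 (level \<Gamma> V B \<sigma> (Suc k)))"
    using Seq.IH(2)[OF ty(2) sub(2)] by blast
  \<comment> \<open>After \<open>c1\<close> a level \<open>x\<close> has become at most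
    \<open>x + poly p1 x\<close>, which is the argument for \<open>p2\<close>; the final 1 is the
    node of \<open>Seq\<close>.\<close>
  let ?p = "p1 + (p2 \<circ>\<^sub>p ([:0, 1:] + p1)) + 1"
  show ?case
  proof (intro exI[of _ ?p] allI impI)
    fix \<phi> B \<sigma> \<tau> n assume \<phi>: "\<forall>w. length (\<phi> w) \<le> B" and "exec sem \<phi> \<sigma> (Seq c1 c2) \<tau> n"
    then obtain \<rho> n1 n2 where ex: "exec sem \<phi> \<sigma> c1 \<rho> n1" "exec sem \<phi> \<rho> c2 \<tau> n2"
      and n: "n = n1 + n2 + 1" by (auto elim: exec_SeqE)
    note 1 = p1[OF \<phi> ex(1)] and 2 = p2[OF \<phi> ex(2)]
    have step: "level \<Gamma> V B \<rho> k \<le> level \<Gamma> V B \<sigma> l + poly p1 (level \<Gamma> V B \<sigma> l)"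
      if "l \<le> k" for k l
      using 1 level_antimono[OF V that, of \<Gamma> B \<sigma>]
        poly_nat_mono[OF level_antimono[OF V le_SucI[OF that], of \<Gamma> B \<sigma>], of p1]
      by (meson add_mono order_trans)
    have p2_step: "poly p2 (level \<Gamma> V B \<rho> k) \<le>
        poly p2 (level \<Gamma> V B \<sigma> l + poly p1 (level \<Gamma> V B \<sigma> l))" if "l \<le> k" for k l
      by (intro poly_nat_mono step that)
    have "n \<le> poly ?p (level \<Gamma> V B \<sigma> 0)"
      using 1 2 n p2_step[of 0 0] by (simp add: poly_pcompose)
    moreover have "level \<Gamma> V B \<tau> k \<le> level \<Gamma> V B \<sigma> k + poly ?p (level \<Gamma> V B \<sigma> (Suc k))" for k
      using conjunct2[OF 1, rule_format, of k] conjunct2[OF 2, rule_format, of k]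
        p2_step[of "Suc k" "Suc k"] by (simp add: poly_pcompose)
    ultimately show "n \<le> poly ?p (level \<Gamma> V B \<sigma> 0) \<and>
      (\<forall>k. level \<Gamma> V B \<tau> k \<le> level \<Gamma> V B \<sigma> k + poly ?p (level \<Gamma> V B \<sigma> (Suc k)))" by blast
  qed
next
  case (Cond e c1 c0)
  obtain t' where ty: "type_com ar \<Gamma> \<Delta> c1 (t', t_in, t_out)" "type_com ar \<Gamma> \<Delta> c0 (t', t_in, t_out)"
    using Cond.prems(1) by (rule type_com_Cond)
  have sub: "set1_com c1 \<subseteq> V" "set1_com c0 \<subseteq> V" using Cond.prems(2) by auto
  obtain p1 :: "nat poly" where p1: "\<And>\<phi> B \<sigma> \<tau> n. \<forall>w. length (\<phi> w) \<le> B \<Longrightarrow> exec sem \<phi> \<sigma> c1 \<tau> n \<Longrightarrow>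
    n \<le> poly p1 (level \<Gamma> V B \<sigma> 0) \<and>
    (\<forall>k. level \<Gamma> V B \<tau> k \<le> level \<Gamma> V B \<sigma> k + poly p1 (level \<Gamma> V B \<sigma> (Suc k)))"
    using Cond.IH(1)[OF ty(1) sub(1)] by blast
  obtain p0 :: "nat poly" where p0: "\<And>\<phi> B \<sigma> \<tau> n. \<forall>w. length (\<phi> w) \<le> B \<Longrightarrow> exec sem \<phi> \<sigma> c0 \<tau> n \<Longrightarrow>
    n \<le> poly p0 (level \<Gamma> V B \<sigma> 0) \<and>
    (\<forall>k. level \<Gamma> V B \<tau> k \<le> level \<Gamma> V B \<sigma> k + poly p0 (level \<Gamma> V B \<sigma> (Suc k)))"
    using Cond.IH(2)[OF ty(2) sub(2)] by blast
  let ?p = "p1 + p0 + [:expr_nodes e + 1:]"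
  show ?case
  proof (intro exI[of _ ?p] allI impI)
    fix \<phi> B \<sigma> \<tau> n assume \<phi>: "\<forall>w. length (\<phi> w) \<le> B" and "exec sem \<phi> \<sigma> (Cond e c1 c0) \<tau> n"
    then obtain n' where n: "n = n' + expr_nodes e + 1"
      and ex: "exec sem \<phi> \<sigma> c1 \<tau> n' \<or> exec sem \<phi> \<sigma> c0 \<tau> n'"
      by (auto elim: exec_CondE)
    show "n \<le> poly ?p (level \<Gamma> V B \<sigma> 0) \<and>
      (\<forall>k. level \<Gamma> V B \<tau> k \<le> level \<Gamma> V B \<sigma> k + poly ?p (level \<Gamma> V B \<sigma> (Suc k)))"
    proof (intro conjI allI)
      show "n \<le> poly ?p (level \<Gamma> V B \<sigma> 0)"
        using ex p1[OF \<phi>, of \<sigma> \<tau> n'] p0[OF \<phi>, of \<sigma> \<tau> n'] by (auto simp: n)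
    next
      fix k
      have "level \<Gamma> V B \<tau> k \<le> level \<Gamma> V B \<sigma> k + poly p1 (level \<Gamma> V B \<sigma> (Suc k)) \<or>
          level \<Gamma> V B \<tau> k \<le> level \<Gamma> V B \<sigma> k + poly p0 (level \<Gamma> V B \<sigma> (Suc k))"
        using ex p1[OF \<phi>] p0[OF \<phi>] by blast
      then show "level \<Gamma> V B \<tau> k \<le> level \<Gamma> V B \<sigma> k + poly ?p (level \<Gamma> V B \<sigma> (Suc k))"
        by auto
    qed
  qed
next
  case (While e c)
  obtain t' t_out' where ty: "type_expr ar \<Gamma> \<Delta> e (t', t_in, t_out')"
    "type_com ar \<Gamma> \<Delta> c (t', t', t_out')"
    using While.prems(1) by (rule type_com_While)
  have sub: "set1_expr e \<subseteq> V" "set1_com c \<subseteq> V" using While.prems(2) by auto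
  obtain p :: "nat poly" where p: "\<And>\<phi> B \<sigma> \<tau> n. \<forall>w. length (\<phi> w) \<le> B \<Longrightarrow> exec sem \<phi> \<sigma> c \<tau> n \<Longrightarrow>
    n \<le> poly p (level \<Gamma> V B \<sigma> 0) \<and>
    (\<forall>k. level \<Gamma> V B \<tau> k \<le> level \<Gamma> V B \<sigma> k + poly p (level \<Gamma> V B \<sigma> (Suc k)))"
    using While.IH[OF ty(2) sub(2)] by blast
  obtain P :: "nat poly" and K where PK: "\<And>\<phi> B N s m. val sem \<phi> (s N) e = [0] \<Longrightarrow>
    \<forall>i<N. val sem \<phi> (s i) e = [1] \<and> exec sem \<phi> (s i) c (s (Suc i)) (m i) \<Longrightarrow>
    N \<le> poly P (level \<Gamma> V B (s 0) t') \<and>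
    (\<forall>i\<le>N. \<forall>k\<ge>t'. level \<Gamma> V B (s i) k \<le> level \<Gamma> V B (s 0) k + K)"
    using While_iterations[OF V sub ty] by blast
  \<comment> \<open>The constant is the cost of one round outside the body: the guard, the loop node
    and the sequence node.\<close>
  let ?p = "p + [:expr_nodes e + 2:]"
  \<comment> \<open>Index 0 will hold the cost, so tier \<open>t'\<close> sits at index
    \<open>Suc t'\<close>.\<close>
  have Suc_t': "1 \<le> Suc t'" by simp
  obtain q :: "nat poly" where q: "\<And>(f :: nat \<Rightarrow> nat \<Rightarrow> nat) N.
    \<forall>a b. 1 \<le> a \<and> a \<le> b \<longrightarrow> f 0 b \<le> f 0 a \<Longrightarrow>
    \<forall>i<N. \<forall>k. f (Suc i) k \<le> f i k + poly ?p (f i (Suc k)) \<Longrightarrow>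
    \<forall>i\<le>N. \<forall>k\<ge>Suc t'. f i k \<le> f 0 k + K \<Longrightarrow>
    N \<le> poly P (f 0 (Suc t')) \<Longrightarrow>
    \<forall>i\<le>N. \<forall>k. f i k \<le> f 0 k + poly q (f 0 (Suc k))"
    using poly_iteration_growth[of "Suc t'" ?p K P, OF Suc_t'] by blast
  show ?case
  \<comment> \<open>The added constant pays for the last guard evaluation and the closing
    \<open>While0\<close> node.\<close>
  proof (intro exI[of _ "q + [:expr_nodes e + 1:]"] allI impI)
    fix \<phi> B \<sigma> \<tau> n assume \<phi>: "\<forall>w. length (\<phi> w) \<le> B" and ex: "exec sem \<phi> \<sigma> (While e c) \<tau> n"
    obtain N s m where s: "s 0 = \<sigma>" "s N = \<tau>" "val sem \<phi> (s N) e = [0]"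
      and loop: "\<forall>i<N. val sem \<phi> (s i) e = [1] \<and> exec sem \<phi> (s i) c (s (Suc i)) (m i)"
      and n: "n = (\<Sum>i<N. m i + expr_nodes e + 2) + expr_nodes e + 1"
      using exec_While_states[OF ex] by blast
    text \<open>The accumulated cost plays the role of an additional lowest tier.\<close>
    define f where "f i = case_nat (\<Sum>j<i. m j + expr_nodes e + 2) (level \<Gamma> V B (s i))" for i
    have f: "f i 0 = (\<Sum>j<i. m j + expr_nodes e + 2)" "f i (Suc k) = level \<Gamma> V B (s i) k" for i k
      by (simp_all add: f_def)
    have *: "\<forall>i\<le>N. \<forall>k. f i k \<le> f 0 k + poly q (f 0 (Suc k))"
    proof (rule q)
      show "\<forall>a b. 1 \<le> a \<and> a \<le> b \<longrightarrow> f 0 b \<le> f 0 a"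
      proof (intro allI impI)
        fix a b :: nat assume "1 \<le> a \<and> a \<le> b"
        then show "f 0 b \<le> f 0 a"
          by (cases a; cases b) (auto simp: f intro: level_antimono[OF V])
      qed
      show "\<forall>i<N. \<forall>k. f (Suc i) k \<le> f i k + poly ?p (f i (Suc k))"
      proof (intro allI impI)
        fix i k assume "i < N"
        then have "exec sem \<phi> (s i) c (s (Suc i)) (m i)" using loop by simp
        note body = p[OF \<phi> this]
        show "f (Suc i) k \<le> f i k + poly ?p (f i (Suc k))"
        proof (cases k)
          case 0
          then show ?thesis using body by (simp add: f)
        next
          case (Suc l)
          then show ?thesis using conjunct2[OF body, rule_format, of l] by (simp add: f)
        qed
      qed
      show "\<forall>i\<le>N. \<forall>k\<ge>Suc t'. f i k \<le> f 0 k + K"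
      proof (intro allI impI)
        fix i k assume "i \<le> N" "Suc t' \<le> k"
        then show "f i k \<le> f 0 k + K"
          using conjunct2[OF PK[OF s(3) loop], rule_format, of i "k - 1"] by (cases k) (simp_all add: f)
      qed
      show "N \<le> poly P (f 0 (Suc t'))"
        using PK[OF s(3) loop] by (simp add: f)
    qed
    have "n \<le> poly (q + [:expr_nodes e + 1:]) (level \<Gamma> V B \<sigma> 0)"
      using *[rule_format, of N 0] s(1) by (simp only: f n) (simp add: f)
    moreover have "level \<Gamma> V B \<tau> k \<le>
        level \<Gamma> V B \<sigma> k + poly (q + [:expr_nodes e + 1:]) (level \<Gamma> V B \<sigma> (Suc k))" for k
      using *[rule_format, of N "Suc k"] s(1,2) by (simp add: f)
    ultimately show "n \<le> poly (q + [:expr_nodes e + 1:]) (level \<Gamma> V B \<sigma> 0) \<and>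
      (\<forall>k. level \<Gamma> V B \<tau> k \<le>
        level \<Gamma> V B \<sigma> k + poly (q + [:expr_nodes e + 1:]) (level \<Gamma> V B \<sigma> (Suc k)))"
      by blast
  qed
qed

end

section \<open>The bound for whole programs\<close>

lemma length_total_store_le:
  assumes "finite_size \<mu>"
  shows "length (total_store \<mu> x) \<le> store_size \<mu>"
proof (cases "x \<in> nonempty_vars \<mu>")
  case True
  then have "length (the (\<mu> x)) \<le> store_size \<mu>"
    using assms unfolding store_size_def finite_size_def by (intro member_le_sum) auto
  then show ?thesis using True by (auto simp: nonempty_vars_def total_store_def)
qed (auto simp: nonempty_vars_def total_store_def split: option.splits)

theorem theorem6p9:
  fixes ar :: "'f \<Rightarrow> nat"
    and sem :: "'f \<Rightarrow> 'a::{finite, zero_neq_one} word list \<Rightarrow> 'a word"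
    and \<Gamma> :: "'v var_env" and \<Delta> :: "'f op_env"
    and p :: "('v, 'f) prog"
  assumes "wf_op_env ar \<Delta>"
    and "safe_op_env ar sem \<Delta>"
    and "safe_prog ar sem \<Gamma> \<Delta> p"
  shows "\<exists>P :: nat poly. \<forall>(\<phi> :: 'a word \<Rightarrow> 'a word) (\<mu> :: ('v, 'a) store) \<pi> w.
    finite_size \<mu> \<longrightarrow> derivation ar sem \<phi> \<pi> \<longrightarrow> concl \<pi> = EvalP \<mu> p w \<longrightarrow>
      num_nodes \<pi> \<le> poly P (max_size \<mu> \<pi>)"
proof -
  obtain c x where p: "p = Return c x" by (cases p)
  with assms(3) obtain t t_in t_out where "type_com ar \<Gamma> \<Delta> c (t, t_in, t_out)" by auto
  from com_growth[OF assms(2) this subset_refl finite_set1_com]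
  obtain q :: "nat poly" where q: "\<And>\<phi> B \<sigma> \<tau> n. \<forall>w. length (\<phi> w) \<le> B \<Longrightarrow> exec sem \<phi> \<sigma> c \<tau> n \<Longrightarrow>
    n \<le> poly q (level \<Gamma> (set1_com c) B \<sigma> 0)"
    by blast
  show ?thesis
  \<comment> \<open>The summand 1 is the node of the \<open>Return\<close> rule.\<close>
  proof (intro exI[of _ "q + 1"] allI impI)
    fix \<phi> :: "'a word \<Rightarrow> 'a word" and \<mu> :: "('v, 'a) store" and \<pi> w
    assume fin: "finite_size \<mu>" and "derivation ar sem \<phi> \<pi>" and concl: "concl \<pi> = EvalP \<mu> p w"
    then obtain \<pi>s J where \<pi>: "\<pi> = Infer J \<pi>s" and rule: "rule_instance ar sem \<phi> (map concl \<pi>s) J"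
      and subtrees: "\<And>\<pi>'. \<pi>' \<in> set \<pi>s \<Longrightarrow> derivation ar sem \<phi> \<pi>'"
      by (auto elim: derivation.cases)
    from rule concl obtain \<pi>1 \<mu>' where \<pi>1: "\<pi>s = [\<pi>1]" "concl \<pi>1 = EvalC \<mu> c \<mu>'"
      unfolding \<pi> p by (cases rule: rule_instance.cases) (auto simp: map_eq_Cons_conv)
    \<comment> \<open>\<open>B\<close> depends on the derivation, which is harmless because
      \<open>q\<close> was obtained uniformly in \<open>B\<close> and the oracle. It bounds both the
      initial store and all answers, so the initial level at tier 0 is at most
      \<open>B\<close>.\<close>
    define B where "B = max_size \<mu> \<pi>"
    have B: "store_size \<mu> \<le> B" "\<forall>w\<in>oracle_answers \<pi>. length w \<le> B"
      by (simp_all add: B_def max_size_def finite_oracle_answers)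
    have "\<forall>w\<in>oracle_answers \<pi>1. length w \<le> B"
      using B(2) oracle_answers_subtree[of \<pi>1 \<pi>s J] \<pi>1(1) \<pi> by auto
    then have "exec sem (cap B \<phi>) (total_store \<mu>) c (total_store \<mu>') (num_nodes \<pi>1)"
      using derivation_com[OF subtrees \<pi>1(2)] \<pi>1(1) by simp
    then have "num_nodes \<pi>1 \<le> poly q (level \<Gamma> (set1_com c) B (total_store \<mu>) 0)"
      by (rule q[rotated]) (simp add: cap_def)
    also have "\<dots> \<le> poly q B"
    proof (rule poly_nat_mono)
      show "level \<Gamma> (set1_com c) B (total_store \<mu>) 0 \<le> B"
        using length_total_store_le[OF fin] B(1)
        by (auto simp: level_le_iff finite_set1_com intro: order_trans)
    qed
    finally show "num_nodes \<pi> \<le> poly (q + 1) (max_size \<mu> \<pi>)"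
      by (simp add: \<pi> \<pi>1(1) B_def)
  qed
qed

end
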